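(* Let $A\subset\mathbb{R}^m$ be a finite set whose convex hull $P=\mathrm{conv}(A)$ has dimension $m$, let $\alpha_a>0$ for $a\in A$, let $a_0\in\mathbb{R}^m\setminus A$ and $\alpha_0>0$. Let $\mathcal{E}(x)=\sum_{a\in A}\xi_a\alpha_ae^{\langle a,x\rangle}$ and $\mathcal{E}_0(x)=\mathcal{E}(x)+\xi_0\alpha_0e^{\langle a_0,x\rangle}$, where $\xi_0$ and $\xi_a$ ($a\in A$) are independent standard real Gaussian variables. If $d(a_0,P)>\mathrm{diam}(P)/m$, then there exists a non-empty unbounded open set $U\subset\mathbb{R}^m$ such that $$\mathbb{E}\mathbb{S}\{\mathcal{E}_0;U\}<\mathbb{E}\mathbb{S}\{\mathcal{E};U\}.$$
   Context: $d(a_0,P)$ is the Euclidean distance from $a_0$ to $P$ and $\mathrm{diam}(P)=\max\{\|p_1-p_2\|\mid p_1,p_2\in P\}$. For a random function $\mathcal{X}:\mathbb{R}^m\to\mathbb{R}$ and an open set $U\subset\mathbb{R}^m$, $\mathbb{E}\mathbb{S}\{\mathcal{X};U\}$ denotes the expected number of points $x\in U$ with $\mathcal{X}_1(x)=\dots=\mathcal{X}_m(x)=0$, where $\mathcal{X}_1,\dots,\mathcal{X}_m$ are i.i.d. copies of $\mathcal{X}$. *)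

theory Defs
  imports "HOL-Probability.Probability"
begin

(* The random exponential sum with support A, coefficients \<alpha> and random
   variables \<xi> a; the first argument of the resulting random function is the
   outcome, the second one the point of R^m. *)
definition exp_sum ::
  "(real^'m) set \<Rightarrow> (real^'m \<Rightarrow> 'w \<Rightarrow> real) \<Rightarrow> (real^'m \<Rightarrow> real) \<Rightarrow> 'w \<Rightarrow> real^'m \<Rightarrow> real" where
  "exp_sum A \<xi> \<alpha> = (\<lambda>\<omega> x. \<Sum>a\<in>A. \<xi> a \<omega> * \<alpha> a * exp (a \<bullet> x))"

definition add_exp_term ::
  "('w \<Rightarrow> real^'m \<Rightarrow> real) \<Rightarrow> real^'m \<Rightarrow> ('w \<Rightarrow> real) \<Rightarrow> real \<Rightarrow> 'w \<Rightarrow> real^'m \<Rightarrow> real" where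
  "add_exp_term X a0 \<xi>0 \<alpha>0 = (\<lambda>\<omega> x. X \<omega> x + \<xi>0 \<omega> * \<alpha>0 * exp (a0 \<bullet> x))"

(* Expected number of zeros in U of a system of m = CARD('m) i.i.d. copies of the
   random function X on the probability space M. The copies are the coordinate
   copies \<lambda>\<omega>. X (\<omega> i) on the product space M^m. The number of zeros is the counting
   measure of the zero set, so it is infinite if there are infinitely many zeros.
   The Lebesgue integral here is the true expectation when the number of zeros is
   measurable; for U open and X built from finitely many real random variables
   depending continuously on the point x, this is the case. *)
definition expected_zeros ::
  "'w measure \<Rightarrow> ('w \<Rightarrow> real^'m \<Rightarrow> real) \<Rightarrow> (real^'m) set \<Rightarrow> ennreal" where
  "expected_zeros M X U =
     (\<integral>\<^sup>+ \<omega>. emeasure (count_space UNIV) {x \<in> U. \<forall>i. X (\<omega> i) x = 0}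
        \<partial>(\<Pi>\<^sub>M i\<in>(UNIV :: 'm set). M))"

end

theory Submission
  imports Defs
begin

text \<open>
  A crude form of the Kac--Rice formula suffices, because the two expectations differ by an
  exponentially large factor far out in the direction \<open>u\<close> from the point of \<open>P\<close> closest to
  \<open>a0\<close> towards \<open>a0\<close>.

  Fix an exponent \<open>p\<close> and divide the system by its \<open>p\<close>-th term: \<open>x\<close> is a zero iff the
  Gaussian coefficient vector of \<open>p\<close> equals \<open>h(x)\<close>, where \<open>h\<close> depends on the other
  coefficients only. Hence the probability of a zero in a small set \<open>Q\<close> is the Gaussian measure
  of \<open>h(Q)\<close>, comparable to \<open>|det Dh|\<close> times the volume of \<open>Q\<close>, and by multilinearity
  \<open>det Dh\<close> is a sum over maps \<open>f\<close> from the rows to the exponents of products of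
  coefficients, of \<open>\<Prod>i. \<alpha> (f i) / \<alpha> p * exp ((f i - p) \<bullet> x)\<close> and of
  \<open>det (\<chi> i. f i - p)\<close>.

  With \<open>p = a0\<close> this bounds the number of zeros of the enlarged system from above; with \<open>p\<close>
  the dominant exponent \<open>a1\<close> of \<open>A\<close> at \<open>x = T u\<close> it gives a lower bound for the
  original system. Passing from \<open>a0\<close> to \<open>a1\<close> gains \<open>exp (- T d)\<close> in each of the
  \<open>m\<close> factors, and making the chosen exponents affinely independent from \<open>a1\<close> costs the
  exchange of at most one of them, hence at most \<open>exp (T diam P)\<close>. Since \<open>m d > diam P\<close>,
  the original system wins on a small ball around \<open>T u\<close> for large \<open>T\<close>; a thin open
  neighbourhood of the points \<open>k u\<close> makes the set unbounded at negligible cost.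
\<close>

section \<open>Change of variables over an arbitrary finite index type\<close>

lemma prod_Basis_cart:
  "(\<Prod>b\<in>(Basis :: (real^'m) set). F b) = (\<Prod>i\<in>UNIV. F (axis i 1))"
proof -
  have B: "(Basis :: (real^'m) set) = (\<lambda>i. axis i 1) ` UNIV"
    by (auto simp: Basis_vec_def)
  have "inj (\<lambda>i::'m. axis i (1::real))"
    by (auto simp: inj_def axis_eq_axis)
  then show ?thesis
    unfolding B by (simp add: prod.reindex)
qed

text \<open>
  The library's change of variables theorems require the index type to be well-ordered. A finite
  type need not be in that class, but a copy of it can be ordered through an enumeration.
\<close>

typedef ('m::finite) ordered_copy = "UNIV :: 'm set"
  by simp

instantiation ordered_copy :: (finite) "{finite, wellorder}"
begin

definition less_eq_ordered_copy :: "'a ordered_copy \<Rightarrow> 'a ordered_copy \<Rightarrow> bool" where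
  "x \<le> y \<longleftrightarrow> to_nat (Rep_ordered_copy x) \<le> to_nat (Rep_ordered_copy y)"

definition less_ordered_copy :: "'a ordered_copy \<Rightarrow> 'a ordered_copy \<Rightarrow> bool" where
  "x < y \<longleftrightarrow> to_nat (Rep_ordered_copy x) < to_nat (Rep_ordered_copy y)"

instance
proof
  fix P :: "'a ordered_copy \<Rightarrow> bool" and a :: "'a ordered_copy"
  assume step: "\<And>x. (\<And>y. y < x \<Longrightarrow> P y) \<Longrightarrow> P x"
  show "P a"
    by (induction a rule: measure_induct_rule[where f = "\<lambda>x. to_nat (Rep_ordered_copy x)"])
      (use step in \<open>auto simp: less_ordered_copy_def\<close>)
next
  have "UNIV = Abs_ordered_copy ` (UNIV :: 'a set)"
    by (metis Rep_ordered_copy_inverse surj_def)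
  then show "finite (UNIV :: 'a ordered_copy set)"
    by (metis finite finite_imageI)
qed (auto simp: less_eq_ordered_copy_def less_ordered_copy_def Rep_ordered_copy_inject)

end

lemma bij_Rep_ordered_copy: "bij Rep_ordered_copy"
  by (metis Abs_ordered_copy_inverse Rep_ordered_copy_inverse UNIV_I bijI')

text \<open>Conjugation by the bijection \<open>f\<close> carries the permutations of one index type
  onto those of the other and preserves signs, so the two Leibniz sums agree term by term.\<close>

lemma det_reindex:
  fixes A :: "real^'m^'m" and f :: "'n::finite \<Rightarrow> 'm"
  assumes f: "bij f"
  shows "det (\<chi> i j. A $ f i $ f j) = det A"
proof -
  have inj: "inj f" using f by (simp add: bij_def)
  have im: "bij_betw (map_permutation UNIV f) {p. p permutes UNIV} {p. p permutes (UNIV::'m set)}"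
  proof (rule bij_betw_byWitness[where f' = "map_permutation UNIV (inv f)"])
    show "map_permutation UNIV f ` {p. p permutes UNIV} \<subseteq> {p. p permutes UNIV}"
      using f by (auto intro!: map_permutation_permutes)
    show "map_permutation UNIV (inv f) ` {p. p permutes UNIV} \<subseteq> {p. p permutes UNIV}"
      using bij_imp_bij_inv[OF f] by (auto intro!: map_permutation_permutes)
    show "\<forall>p\<in>{p. p permutes UNIV}. map_permutation UNIV (inv f) (map_permutation UNIV f p) = p"
      using f by (auto intro!: map_permutation_compose_inv simp: bij_def)
    show "\<forall>p\<in>{p. p permutes UNIV}. map_permutation UNIV f (map_permutation UNIV (inv f) p) = p"
      using f bij_imp_bij_inv[OF f] by (auto intro!: map_permutation_compose_inv simp: bij_def surj_f_inv_f)
  qed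
  have "det A = (\<Sum>p | p permutes (UNIV::'m set). of_int (sign p) * (\<Prod>i\<in>UNIV. A $ i $ p i))"
    by (simp add: det_def)
  also have "\<dots> = (\<Sum>p | p permutes (UNIV::'n set). of_int (sign (map_permutation UNIV f p))
      * (\<Prod>i\<in>UNIV. A $ i $ map_permutation UNIV f p i))"
    by (rule sum.reindex_bij_betw[OF im, symmetric])
  also have "\<dots> = (\<Sum>p | p permutes (UNIV::'n set). of_int (sign p) * (\<Prod>i\<in>UNIV. A $ f i $ f (p i)))"
  proof (rule sum.cong[OF refl])
    fix p :: "'n \<Rightarrow> 'n" assume p: "p \<in> {p. p permutes UNIV}"
    have "(\<Prod>i\<in>UNIV. A $ i $ map_permutation UNIV f p i)
        = (\<Prod>i\<in>UNIV. A $ f i $ map_permutation UNIV f p (f i))"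
      by (rule prod.reindex_bij_betw[OF f, symmetric])
    then show "of_int (sign (map_permutation UNIV f p)) * (\<Prod>i\<in>UNIV. A $ i $ map_permutation UNIV f p i)
        = of_int (sign p) * (\<Prod>i\<in>UNIV. A $ f i $ f (p i))"
      using p inj by (simp add: sign_map_permutation map_permutation_apply)
  qed
  finally show ?thesis
    by (simp add: det_def)
qed

definition reindex :: "('n \<Rightarrow> 'm) \<Rightarrow> real^'m \<Rightarrow> real^'n" where
  "reindex f x = (\<chi> i. x $ f i)"

lemma linear_reindex: "linear (reindex f)"
  by (auto simp: linear_iff reindex_def vec_eq_iff)

lemma reindex_inv: "bij f \<Longrightarrow> reindex f (reindex (inv f) x) = x"
  "bij f \<Longrightarrow> reindex (inv f) (reindex f y) = y"
  by (simp_all add: reindex_def vec_eq_iff bij_def surj_f_inv_f)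

lemma measurable_reindex [measurable]:
  "reindex (f :: 'n::finite \<Rightarrow> 'm::finite) \<in> borel_measurable borel"
  by (intro borel_measurable_continuous_onI linear_continuous_on linear_conv_bounded_linear[THEN iffD1] linear_reindex)

text \<open>Lebesgue measure is determined by its values on boxes, and relabelling coordinates
  merely permutes the side lengths of a box.\<close>

lemma distr_lborel_reindex:
  fixes f :: "'n::finite \<Rightarrow> 'm::finite"
  assumes f: "bij f"
  shows "lborel = distr lborel borel (reindex f)"
proof (rule lborel_eqI)
  fix l u :: "real^'n"
  assume le: "\<And>b. b \<in> Basis \<Longrightarrow> l \<bullet> b \<le> u \<bullet> b"
  have vi: "reindex f -` box l u = box (reindex (inv f) l) (reindex (inv f) u)"
  proof -
    have "(\<forall>i. P (f i) i) \<longleftrightarrow> (\<forall>j. P j (inv f j))" for P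
      using f by (metis bij_inv_eq_iff)
    from this[of "\<lambda>j i. l $ i < x $ j \<and> x $ j < u $ i" for x] show ?thesis
      by (simp add: set_eq_iff reindex_def mem_box_cart)
  qed
  have le': "l $ i \<le> u $ i" for i
    using le[of "axis i 1"] by (simp add: inner_axis axis_in_Basis_iff)
  have "emeasure (distr lborel borel (reindex f)) (box l u)
      = emeasure lborel (box (reindex (inv f) l) (reindex (inv f) u))"
    by (simp add: emeasure_distr vi)
  also have "\<dots> = (\<Prod>i\<in>UNIV. (u - l) $ (inv f i))"
  proof -
    have "(reindex (inv f) l) \<bullet> b \<le> (reindex (inv f) u) \<bullet> b" if "b \<in> Basis" for b
      using that le' by (auto simp: Basis_vec_def inner_axis reindex_def)
    then show ?thesis
      by (simp add: emeasure_lborel_box prod_Basis_cart inner_axis reindex_def)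
  qed
  also have "(\<Prod>i\<in>UNIV. (u - l) $ (inv f i)) = (\<Prod>i\<in>UNIV. (u - l) $ i)"
    using prod.reindex_bij_betw[OF bij_imp_bij_inv[OF f], of "\<lambda>i. (u-l)$i"] .
  also have "\<dots> = (\<Prod>b\<in>Basis. (u - l) \<bullet> b)"
    by (simp add: prod_Basis_cart inner_axis)
  finally show "emeasure (distr lborel borel (reindex f)) (box l u) = (\<Prod>b\<in>Basis. (u - l) \<bullet> b)" .
qed simp

lemma vimage_reindex:
  assumes "bij f"
  shows "reindex f ` S = reindex (inv f) -` S"
proof (intro set_eqI iffI)
  fix y assume "y \<in> reindex (inv f) -` S"
  then show "y \<in> reindex f ` S"
    using reindex_inv(1)[OF assms, of y] by (metis image_eqI vimageE)
qed (use reindex_inv(2)[OF assms] in auto)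

lemma sets_reindex_image:
  fixes f :: "'n::finite \<Rightarrow> 'm::finite"
  assumes "bij f" "S \<in> sets borel"
  shows "reindex f ` S \<in> sets borel"
  using measurable_sets[OF measurable_reindex[of "inv f"] assms(2)]
  by (simp add: vimage_reindex assms)

lemma emeasure_reindex_image:
  fixes f :: "'n::finite \<Rightarrow> 'm::finite"
  assumes f: "bij f" and S: "S \<in> sets borel"
  shows "emeasure lborel (reindex f ` S) = emeasure lborel S"
proof -
  have "emeasure lborel (reindex f ` S) = emeasure (distr lborel borel (reindex f)) (reindex f ` S)"
    using distr_lborel_reindex[OF f] by simp
  also have "\<dots> = emeasure lborel (reindex f -` (reindex f ` S))"
    using sets_reindex_image[OF assms] by (simp add: emeasure_distr)
  also have "reindex f -` (reindex f ` S) = S"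
    using reindex_inv(2)[OF f] by (intro inj_vimage_image_eq inj_on_inverseI)
  finally show ?thesis .
qed

text \<open>Specialises the change of variables inequality to a constant Jacobian bound and Borel
  sets, and restates it for \<open>emeasure lborel\<close>. It is an inequality, so \<open>f\<close>
  may be far from injective.\<close>

lemma emeasure_bounded_differentiable_image_ordered:
  fixes f :: "real^'n::{finite,wellorder} \<Rightarrow> real^'n::_"
  assumes S: "S \<in> sets borel" and fS: "f ` S \<in> sets borel"
    and der: "\<And>x. x \<in> S \<Longrightarrow> (f has_derivative f' x) (at x)"
    and bnd: "\<And>x. x \<in> S \<Longrightarrow> \<bar>det (matrix (f' x))\<bar> \<le> B" and B: "0 \<le> B"
    and fin: "emeasure lborel S < \<infinity>"
  shows "emeasure lborel (f ` S) \<le> ennreal B * emeasure lborel S"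
proof -
  have lm: "S \<in> lmeasurable"
    using S fin by (intro fmeasurableI) auto
  have der': "\<And>x. x \<in> S \<Longrightarrow> (f has_derivative f' x) (at x within S)"
    using der has_derivative_at_withinI by blast
  have meas: "(\<lambda>x. det (matrix (f' x))) \<in> borel_measurable (lebesgue_on S)"
    by (rule borel_measurable_det_Jacobian[OF _ der']) (use lm in auto)
  have int: "(\<lambda>x. \<bar>det (matrix (f' x))\<bar>) integrable_on S"
  proof (rule measurable_bounded_by_integrable_imp_integrable_real[where g = "\<lambda>_. B"])
    show "(\<lambda>x. \<bar>det (matrix (f' x))\<bar>) \<in> borel_measurable (lebesgue_on S)"
      using meas by measurable
    show "(\<lambda>_. B) integrable_on S"
      using lm by (simp add: integrable_on_const)
  qed (use bnd lm in auto)
  have im: "f ` S \<in> lmeasurable"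
    by (rule measurable_bounded_differentiable_image[OF lm der' int bnd])
  have "measure lebesgue (f ` S) \<le> B * measure lebesgue S"
    by (rule measure_bounded_differentiable_image[OF lm der' int bnd])
  moreover have "emeasure lborel (f ` S) = ennreal (measure lebesgue (f ` S))"
    using emeasure_eq_measure2[OF im] fS by simp
  moreover have "emeasure lborel S = ennreal (measure lebesgue S)"
    using emeasure_eq_measure2[OF lm] S by simp
  ultimately show ?thesis
    using B by (simp add: ennreal_leI flip: ennreal_mult)
qed

text \<open>Conjugating \<open>f\<close> with the relabelling \<open>?e\<close> moves the problem to
  the ordered index type. Both volumes and the Jacobian determinant are unchanged by this.\<close>

lemma emeasure_bounded_differentiable_image:
  fixes f :: "real^'m \<Rightarrow> real^'m"
  assumes S: "S \<in> sets borel" and fS: "f ` S \<in> sets borel"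
    and der: "\<And>x. x \<in> S \<Longrightarrow> (f has_derivative f' x) (at x)"
    and bnd: "\<And>x. x \<in> S \<Longrightarrow> \<bar>det (matrix (f' x))\<bar> \<le> B" and B: "0 \<le> B"
    and fin: "emeasure lborel S < \<infinity>"
  shows "emeasure lborel (f ` S) \<le> ennreal B * emeasure lborel S"
proof -
  let ?r = "Rep_ordered_copy :: 'm ordered_copy \<Rightarrow> 'm"
  let ?e = "reindex ?r" and ?d = "reindex (inv ?r)"
  have r: "bij ?r" by (rule bij_Rep_ordered_copy)
  let ?g = "\<lambda>y. ?e (f (?d y))"
  let ?g' = "\<lambda>y v. ?e (f' (?d y) (?d v))"
  have im: "?g ` (?e ` S) = ?e ` (f ` S)"
    by (auto simp: image_image reindex_inv[OF r])
  have "emeasure lborel (?g ` (?e ` S)) \<le> ennreal B * emeasure lborel (?e ` S)"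
  proof (rule emeasure_bounded_differentiable_image_ordered[where f' = ?g'])
    show "?e ` S \<in> sets borel" by (rule sets_reindex_image[OF r S])
    show "?g ` ?e ` S \<in> sets borel" unfolding im by (rule sets_reindex_image[OF r fS])
    show "emeasure lborel (?e ` S) < \<infinity>" using fin by (simp only: emeasure_reindex_image[OF r S])
    fix y assume "y \<in> ?e ` S"
    then have y: "?d y \<in> S" by (auto simp: reindex_inv[OF r])
    have bl: "bounded_linear ?e" "bounded_linear ?d"
      by (auto simp: linear_conv_bounded_linear[symmetric] linear_reindex)
    have "((\<lambda>y. f (?d y)) has_derivative (\<lambda>v. f' (?d y) (?d v))) (at y)"
      using has_derivative_compose[OF bounded_linear_imp_has_derivative[OF bl(2)] der[OF y]] .
    then show "(?g has_derivative ?g' y) (at y)"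
      by (rule bounded_linear.has_derivative[OF bl(1)])
    have "matrix (?g' y) = (\<chi> i j. matrix (f' (?d y)) $ ?r i $ ?r j)"
    proof -
      have "?d (axis j 1) = axis (?r j) 1" for j
        unfolding reindex_def vec_eq_iff axis_def using r by (simp add: bij_inv_eq_iff) (metis bij_inv_eq_iff)
      then show ?thesis
        by (simp add: matrix_def vec_eq_iff) (simp add: reindex_def)
    qed
    then show "\<bar>det (matrix (?g' y))\<bar> \<le> B"
      using bnd[OF y] by (simp add: det_reindex[OF r])
  qed (rule B)
  then show ?thesis
    by (simp only: im emeasure_reindex_image[OF r S] emeasure_reindex_image[OF r fS])
qed

section \<open>Solving for one coefficient\<close>

text \<open>The ratio of the deterministic part of term \<open>a\<close> to that of term
  \<open>p\<close> at the point \<open>x\<close>.\<close>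

definition pivot_coeff :: "(real^'m \<Rightarrow> real) \<Rightarrow> real^'m \<Rightarrow> real^'m \<Rightarrow> real^'m \<Rightarrow> real" where
  "pivot_coeff \<beta> p x a = \<beta> a / \<beta> p * exp ((a - p) \<bullet> x)"

text \<open>Applied to \<open>- w\<close>, this is the value that the coefficient column of
  \<open>p\<close> must take for \<open>x\<close> to be a common zero, the other columns being
  \<open>w\<close>.\<close>

definition pivot_map :: "(real^'m \<Rightarrow> real) \<Rightarrow> real^'m \<Rightarrow> (real^'m) set \<Rightarrow> (real^'m \<Rightarrow> real^'m) \<Rightarrow> real^'m \<Rightarrow> real^'m" where
  "pivot_map \<beta> p J w x = (\<Sum>a\<in>J. pivot_coeff \<beta> p x a *\<^sub>R w a)"

definition pivot_deriv :: "(real^'m \<Rightarrow> real) \<Rightarrow> real^'m \<Rightarrow> (real^'m) set \<Rightarrow> (real^'m \<Rightarrow> real^'m) \<Rightarrow> real^'m \<Rightarrow> real^'m \<Rightarrow> real^'m" where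
  "pivot_deriv \<beta> p J w x v = (\<Sum>a\<in>J. pivot_coeff \<beta> p x a *\<^sub>R (((a - p) \<bullet> v) *\<^sub>R w a))"

text \<open>For positive \<beta>, the modulus of the factor that multiplies the monomial
  \<open>\<Prod>i. w (f i) $ i\<close> in the expansion of the Jacobian of
  \<open>pivot_map\<close>.\<close>

definition pivot_weight :: "(real^'m \<Rightarrow> real) \<Rightarrow> real^'m \<Rightarrow> real^'m \<Rightarrow> ('m \<Rightarrow> real^'m) \<Rightarrow> real" where
  "pivot_weight \<beta> p x f = (\<Prod>i\<in>UNIV. pivot_coeff \<beta> p x (f i)) * \<bar>det (\<chi> i. f i - p)\<bar>"

text \<open>What remains of the Jacobian expansion after the random coefficients are stripped off
  and the triangle inequality is applied.\<close>

definition pivot_bound :: "(real^'m \<Rightarrow> real) \<Rightarrow> real^'m \<Rightarrow> (real^'m) set \<Rightarrow> real^'m \<Rightarrow> real" where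
  "pivot_bound \<beta> p J x = (\<Sum>f | \<forall>i. f i \<in> J. pivot_weight \<beta> p x f)"

lemma finite_choices: "finite J \<Longrightarrow> finite {f :: 'm::finite \<Rightarrow> 'a. \<forall>i. f i \<in> J}"
  using finite_PiE[of "UNIV :: 'm set" "\<lambda>_. J"] by (simp add: PiE_def Pi_def)

lemma pivot_map_has_derivative:
  "(pivot_map \<beta> p J w has_derivative pivot_deriv \<beta> p J w x) (at x)"
proof -
  have "((\<lambda>x. pivot_coeff \<beta> p x a) has_derivative (\<lambda>v. pivot_coeff \<beta> p x a * ((a - p) \<bullet> v))) (at x)" for a
  proof -
    have "((\<lambda>x. exp ((a - p) \<bullet> x)) has_derivative (\<lambda>v. exp ((a - p) \<bullet> x) * ((a - p) \<bullet> v))) (at x)"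
      by (auto intro!: derivative_eq_intros)
    from has_derivative_mult_right[OF this, of "\<beta> a / \<beta> p"] show ?thesis
      by (simp only: pivot_coeff_def mult.assoc)
  qed
  from has_derivative_scaleR_left[OF this] show ?thesis
    unfolding pivot_map_def[abs_def] pivot_deriv_def[abs_def] scaleR_scaleR
    by (rule has_derivative_sum)
qed

lemma continuous_on_pivot_map: "continuous_on S (pivot_map \<beta> p J w)"
  by (meson has_derivative_continuous_on has_derivative_at_withinI pivot_map_has_derivative)

lemma continuous_on_pivot_coeff: "continuous_on S (\<lambda>x. pivot_coeff \<beta> p x a)"
  unfolding pivot_coeff_def by (intro continuous_intros)

lemma continuous_on_pivot_bound: "continuous_on S (pivot_bound \<beta> p J)"
  unfolding pivot_bound_def[abs_def] pivot_weight_def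
  by (intro continuous_intros continuous_on_pivot_coeff)

text \<open>Multilinearity in the rows: distribute the product over the sums in each Leibniz term,
  then exchange the two summations.\<close>

lemma det_sum_rows:
  fixes r :: "'m::finite \<Rightarrow> 'a \<Rightarrow> real^'m"
  assumes "finite S"
  shows "det (\<chi> i. \<Sum>a\<in>S. r i a) = (\<Sum>f | \<forall>i. f i \<in> S. det (\<chi> i. r i (f i)))"
proof -
  have "(\<Prod>i\<in>UNIV. \<Sum>a\<in>S. r i a $ p i) = (\<Sum>f | \<forall>i. f i \<in> S. \<Prod>i\<in>UNIV. r i (f i) $ p i)" for p
    using prod_sum_PiE[of "UNIV :: 'm set" "\<lambda>_. S" "\<lambda>i a. r i a $ p i"] assms
    by (simp add: PiE_def Pi_def)
  then have "det (\<chi> i. \<Sum>a\<in>S. r i a) = (\<Sum>p | p permutes UNIV. \<Sum>f | \<forall>i. f i \<in> S.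
      of_int (sign p) * (\<Prod>i\<in>UNIV. r i (f i) $ p i))"
    by (simp add: det_def sum_component sum_distrib_left)
  also have "\<dots> = (\<Sum>f | \<forall>i. f i \<in> S. \<Sum>p | p permutes UNIV.
      of_int (sign p) * (\<Prod>i\<in>UNIV. r i (f i) $ p i))"
    by (rule sum.swap)
  finally show ?thesis
    by (simp add: det_def)
qed

lemma matrix_pivot_deriv:
  "matrix (pivot_deriv \<beta> p J w x) = (\<chi> i. \<Sum>a\<in>J. (pivot_coeff \<beta> p x a * w a $ i) *s (a - p))"
  by (auto simp: matrix_def pivot_deriv_def vec_eq_iff inner_axis algebra_simps intro!: sum.cong)

text \<open>Row \<open>i\<close> of the Jacobian is a combination of the vectors
  \<open>a - p\<close>. Expanding by multilinearity and pulling the scalars out of the rows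
  separates the random part from the deterministic one.\<close>

lemma det_pivot_deriv:
  assumes "finite J"
  shows "det (matrix (pivot_deriv \<beta> p J w x)) =
    (\<Sum>f | \<forall>i. f i \<in> J. (\<Prod>i\<in>UNIV. w (f i) $ i) * ((\<Prod>i\<in>UNIV. pivot_coeff \<beta> p x (f i)) * det (\<chi> i. f i - p)))"
proof -
  have "det (matrix (pivot_deriv \<beta> p J w x))
      = (\<Sum>f | \<forall>i. f i \<in> J. det (\<chi> i. (pivot_coeff \<beta> p x (f i) * w (f i) $ i) *s (f i - p)))"
    unfolding matrix_pivot_deriv by (rule det_sum_rows[OF assms])
  then show ?thesis
    by (simp only: det_rows_mul prod.distrib mult_ac)
qed

lemma pivot_coeff_pos:
  assumes "\<beta> p > 0" "\<beta> a > 0"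
  shows "pivot_coeff \<beta> p x a > 0"
  using assms by (simp add: pivot_coeff_def)

lemma pivot_weight_nonneg:
  assumes "\<beta> p > 0" "\<And>i. \<beta> (f i) > 0"
  shows "pivot_weight \<beta> p x f \<ge> 0"
  unfolding pivot_weight_def
  by (intro mult_nonneg_nonneg prod_nonneg) (auto intro!: less_imp_le pivot_coeff_pos assms)

lemma abs_det_term:
  assumes "\<beta> p > 0" "\<And>i. \<beta> (f i) > 0"
  shows "\<bar>(\<Prod>i\<in>UNIV. w (f i) $ i) * ((\<Prod>i\<in>UNIV. pivot_coeff \<beta> p x (f i)) * det (\<chi> i. f i - p))\<bar>
    = (\<Prod>i\<in>UNIV. \<bar>w (f i) $ i\<bar>) * pivot_weight \<beta> p x f"
  using pivot_coeff_pos[OF assms(1) assms(2)]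
  by (simp add: abs_mult abs_prod pivot_weight_def abs_of_pos)

text \<open>A product over all entries, so that it dominates every monomial of the expansion at once
  and its Gaussian expectation splits into one-dimensional moments.\<close>

definition coeff_bound :: "(real^'m) set \<Rightarrow> (real^'m \<Rightarrow> real^'m) \<Rightarrow> real" where
  "coeff_bound J w = (\<Prod>a\<in>J. \<Prod>i\<in>UNIV. 1 + \<bar>w a $ i\<bar>)"

text \<open>In each row the chosen entry is dominated by its own factor
  \<open>1 + \<bar>w a $ i\<bar>\<close>; all remaining factors are at least 1.\<close>

lemma prod_le_coeff_bound:
  fixes f :: "'m::finite \<Rightarrow> real^'m"
  assumes J: "finite J" and f: "\<And>i. f i \<in> J"
  shows "(\<Prod>i\<in>UNIV. \<bar>w (f i) $ i\<bar>) \<le> coeff_bound J w"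
proof -
  have "(\<Prod>i\<in>UNIV. \<bar>w (f i) $ i\<bar>) \<le> (\<Prod>i\<in>UNIV. \<Prod>a\<in>J. 1 + \<bar>w a $ i\<bar>)"
  proof (rule prod_mono, safe)
    fix i
    have "\<bar>w (f i) $ i\<bar> \<le> (\<Prod>a\<in>{f i}. 1 + \<bar>w a $ i\<bar>)" by simp
    also have "\<dots> \<le> (\<Prod>a\<in>J. 1 + \<bar>w a $ i\<bar>)"
      by (rule prod_mono2) (use J f in auto)
    finally show "\<bar>w (f i) $ i\<bar> \<le> (\<Prod>a\<in>J. 1 + \<bar>w a $ i\<bar>)" .
  qed simp
  then show ?thesis
    unfolding coeff_bound_def by (subst prod.swap)
qed

lemma abs_det_pivot_deriv_le:
  assumes J: "finite J" and \<beta>: "\<beta> p > 0" "\<And>a. a \<in> J \<Longrightarrow> \<beta> a > 0"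
  shows "\<bar>det (matrix (pivot_deriv \<beta> p J w x))\<bar> \<le> coeff_bound J w * pivot_bound \<beta> p J x"
proof -
  have "\<bar>det (matrix (pivot_deriv \<beta> p J w x))\<bar>
      \<le> (\<Sum>f | \<forall>i. f i \<in> J. (\<Prod>i\<in>UNIV. \<bar>w (f i) $ i\<bar>) * pivot_weight \<beta> p x f)"
    unfolding det_pivot_deriv[OF J]
    by (rule order_trans[OF sum_abs]) (use \<beta> in \<open>auto intro!: sum_mono simp: abs_det_term\<close>)
  also have "\<dots> \<le> (\<Sum>f | \<forall>i. f i \<in> J. coeff_bound J w * pivot_weight \<beta> p x f)"
    using \<beta> by (intro sum_mono mult_right_mono prod_le_coeff_bound[OF J] pivot_weight_nonneg) auto
  finally show ?thesis
    by (simp add: pivot_bound_def sum_distrib_left)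
qed

text \<open>The term of \<open>g\<close> dominates the expansion. Every other choice differs from
  \<open>g\<close> in some row and picks up a factor of at most \<eta> there, its remaining entries
  are at most 2, and its weight is no larger. By the condition on \<eta> all these terms together
  make up at most half of the weight of \<open>g\<close>.\<close>

lemma abs_det_pivot_deriv_ge:
  fixes g :: "'m::finite \<Rightarrow> real^'m"
  assumes J: "finite J" and \<beta>: "\<beta> p > 0" "\<And>a. a \<in> J \<Longrightarrow> \<beta> a > 0"
    and g: "\<And>i. g i \<in> J"
    and max: "\<And>f. (\<And>i. f i \<in> J) \<Longrightarrow> pivot_weight \<beta> p x f \<le> pivot_weight \<beta> p x g"
    and w1: "\<And>i. 1 \<le> \<bar>w (g i) $ i\<bar>"
    and w2: "\<And>a i. a \<in> J \<Longrightarrow> \<bar>w a $ i\<bar> \<le> 2"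
    and w3: "\<And>a i. a \<in> J \<Longrightarrow> a \<noteq> g i \<Longrightarrow> \<bar>w a $ i\<bar> \<le> \<eta>"
    and \<eta>: "real (card {f :: 'm \<Rightarrow> real^'m. \<forall>i. f i \<in> J}) * (\<eta> * 2 ^ CARD('m)) \<le> 1 / 2" "0 \<le> \<eta>"
  shows "pivot_weight \<beta> p x g / 2 \<le> \<bar>det (matrix (pivot_deriv \<beta> p J w x))\<bar>"
proof -
  let ?F = "{f :: 'm \<Rightarrow> real^'m. \<forall>i. f i \<in> J}"
  let ?D = "pivot_weight \<beta> p x g"
  define t where "t f = (\<Prod>i\<in>UNIV. w (f i) $ i) * ((\<Prod>i\<in>UNIV. pivot_coeff \<beta> p x (f i)) * det (\<chi> i. f i - p))" for f :: "'m \<Rightarrow> real^'m"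
  have fin: "finite ?F" by (rule finite_choices[OF J])
  have gF: "g \<in> ?F" using g by simp
  have D0: "0 \<le> ?D" using \<beta> g by (intro pivot_weight_nonneg) auto
  have "1 \<le> (\<Prod>i\<in>UNIV. \<bar>w (g i) $ i\<bar>)"
    by (rule prod_ge_1) (rule w1)
  then have main: "?D \<le> \<bar>t g\<bar>"
    unfolding t_def using \<beta> g D0 by (subst abs_det_term) (auto simp: mult_le_cancel_right1)
  have other: "\<bar>t f\<bar> \<le> \<eta> * 2 ^ CARD('m) * ?D" if f: "f \<in> ?F - {g}" for f
  proof -
    obtain k where k: "f k \<noteq> g k" using f by auto
    have fJ: "f i \<in> J" for i using f by auto
    have "(\<Prod>i\<in>UNIV. \<bar>w (f i) $ i\<bar>) = \<bar>w (f k) $ k\<bar> * (\<Prod>i\<in>UNIV - {k}. \<bar>w (f i) $ i\<bar>)"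
      by (simp add: prod.remove)
    also have "\<dots> \<le> \<eta> * 2 ^ CARD('m)"
    proof (rule mult_mono)
      have "(\<Prod>i\<in>UNIV - {k}. \<bar>w (f i) $ i\<bar>) \<le> (\<Prod>i\<in>UNIV - {k}. 2)"
        by (rule prod_mono) (use w2 fJ in auto)
      also have "\<dots> \<le> 2 ^ CARD('m)" by simp
      finally show "(\<Prod>i\<in>UNIV - {k}. \<bar>w (f i) $ i\<bar>) \<le> 2 ^ CARD('m)" .
    qed (use w3[OF fJ k] \<eta> in \<open>auto intro: prod_nonneg\<close>)
    finally have "(\<Prod>i\<in>UNIV. \<bar>w (f i) $ i\<bar>) \<le> \<eta> * 2 ^ CARD('m)" .
    then show ?thesis
      unfolding t_def using \<beta> fJ D0 \<eta> max[OF fJ] pivot_weight_nonneg[of \<beta> p f x]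
      by (subst abs_det_term) (auto intro!: mult_mono)
  qed
  have "\<bar>\<Sum>f\<in>?F - {g}. t f\<bar> \<le> (\<Sum>f\<in>?F - {g}. \<eta> * 2 ^ CARD('m) * ?D)"
    by (rule order_trans[OF sum_abs sum_mono[OF other]])
  also have "\<dots> \<le> real (card ?F) * (\<eta> * 2 ^ CARD('m)) * ?D"
  proof -
    have "real (card (?F - {g})) \<le> real (card ?F)"
      using fin by (intro of_nat_mono card_mono) auto
    then show ?thesis
      using D0 \<eta>(2) by (simp add: mult.assoc mult_right_mono)
  qed
  also have "\<dots> \<le> 1 / 2 * ?D"
    by (rule mult_right_mono[OF \<eta>(1) D0])
  finally have rest: "\<bar>\<Sum>f\<in>?F - {g}. t f\<bar> \<le> ?D / 2" by simp
  have "det (matrix (pivot_deriv \<beta> p J w x)) = t g + (\<Sum>f\<in>?F - {g}. t f)"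
    unfolding det_pivot_deriv[OF J] t_def using fin gF by (rule sum.remove)
  then show ?thesis
    using main rest by linarith
qed

section \<open>Volume of images of small balls, from below\<close>

text \<open>Near \<open>x0\<close> the map has a differentiable inverse by the inverse function
  theorem. The Jacobian of the inverse is at most \<open>2 / d\<close> on the image of a small ball,
  so the upper volume bound applied to the inverse is a lower bound for the image.\<close>

lemma image_cball_measure_ge:
  fixes w :: "real^'m \<Rightarrow> real^'m"
  assumes det: "0 < d" "d \<le> \<bar>det (matrix (pivot_deriv \<beta> p J w x0))\<bar>"
  shows "\<forall>\<^sub>F r in at_right 0. ennreal (d / 2) * emeasure lborel (cball x0 r)
     \<le> emeasure lborel (pivot_map \<beta> p J w ` cball x0 r)"
proof -
  let ?h = "pivot_map \<beta> p J w" and ?h' = "pivot_deriv \<beta> p J w"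
  \<comment> \<open>The derivative as an element of the normed space of bounded linear maps, where
    its continuity in \<open>x\<close>, a hypothesis of the inverse function theorem, can be
    stated.\<close>
  define H where "H x = (\<Sum>a\<in>J. pivot_coeff \<beta> p x a *\<^sub>R Blinfun (\<lambda>v. ((a - p) \<bullet> v) *\<^sub>R w a))" for x
  have bl: "bounded_linear (\<lambda>v. ((a - p) \<bullet> v) *\<^sub>R w a)" for a
    by (intro bounded_linear_intros)
  have H: "blinfun_apply (H x) = ?h' x" for x
    by (simp add: H_def pivot_deriv_def fun_eq_iff blinfun.sum_left blinfun.scaleR_left
        bounded_linear_Blinfun_apply[OF bl])
  have contH: "continuous_on UNIV H"
    unfolding H_def by (intro continuous_intros continuous_on_pivot_coeff)
  have lin: "linear (?h' x)" for x
    using bounded_linear.linear[OF blinfun.bounded_linear_right[of "H x"]] unfolding H .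
  have "det (matrix (?h' x0)) \<noteq> 0" using det by auto
  then obtain L where L: "linear L" "L \<circ> ?h' x0 = id" "?h' x0 \<circ> L = id"
    using lin[of x0] by (metis invertible_det_nz matrix_invertible)
  have invL: "Blinfun L o\<^sub>L H x0 = id_blinfun"
    using L by (intro blinfun_eqI)
      (simp add: bounded_linear_Blinfun_apply linear_conv_bounded_linear[symmetric] H fun_eq_iff)
  obtain U' V g g' where U: "open U'" "x0 \<in> U'" and V: "open V" "homeomorphism U' V ?h g"
    and dg: "\<And>y. y \<in> V \<Longrightarrow> (g has_derivative (g' y)) (at y)"
      "\<And>y. y \<in> V \<Longrightarrow> g' y = inv (blinfun_apply (H (g y)))"
      "\<And>y. y \<in> V \<Longrightarrow> bij (blinfun_apply (H (g y)))"
    using inverse_function_theorem[OF open_UNIV _ contH UNIV_I invL, of ?h]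
      pivot_map_has_derivative unfolding H by (metis (no_types, lifting))
  have contdet: "continuous (at x0) (\<lambda>x. \<bar>det (matrix (?h' x))\<bar>)"
  proof -
    have "continuous_on UNIV (\<lambda>x. \<bar>det (matrix (?h' x))\<bar>)"
      unfolding matrix_pivot_deriv det_def
      by (simp, intro continuous_intros continuous_on_pivot_coeff)
    then show ?thesis by (simp add: continuous_on_eq_continuous_at)
  qed
  have "\<forall>\<^sub>F x in at x0. d / 2 < \<bar>det (matrix (?h' x))\<bar>"
    using contdet det unfolding continuous_at by (intro order_tendstoD(1)) auto
  then obtain e1 where e1: "e1 > 0" "\<And>x. x \<noteq> x0 \<Longrightarrow> dist x x0 < e1 \<Longrightarrow> d / 2 < \<bar>det (matrix (?h' x))\<bar>"
    by (auto simp: eventually_at)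
  obtain e2 where e2: "e2 > 0" "ball x0 e2 \<subseteq> U'"
    using U open_contains_ball by blast
  show ?thesis
  proof (rule eventually_at_rightI[of 0 "min e1 e2"])
    fix r assume r: "r \<in> {0<..<min e1 e2}"
    let ?C = "cball x0 r"
    have CU: "?C \<subseteq> U'" using e2 r by (auto simp: subset_iff)
    have detC: "d / 2 < \<bar>det (matrix (?h' x))\<bar>" if "x \<in> ?C" for x
      using e1(2)[of x] det that r by (cases "x = x0") (auto simp: dist_commute)
    have hC: "compact (?h ` ?C)"
      by (intro compact_continuous_image continuous_on_pivot_map) auto
    have gh: "g ` ?h ` ?C = ?C"
      using V(2) CU by (force simp: homeomorphism_def image_image)
    have "emeasure lborel (g ` ?h ` ?C) \<le> ennreal (2 / d) * emeasure lborel (?h ` ?C)"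
    proof (rule emeasure_bounded_differentiable_image[where f' = g'])
      show "?h ` ?C \<in> sets borel" using hC by (simp add: compact_imp_closed)
      show "g ` ?h ` ?C \<in> sets borel" unfolding gh by simp
      show "emeasure lborel (?h ` ?C) < \<infinity>"
        using emeasure_bounded_finite[OF compact_imp_bounded[OF hC]] by simp
      fix y assume y: "y \<in> ?h ` ?C"
      then have yV: "y \<in> V" using V(2) CU by (auto simp: homeomorphism_def)
      have gy: "g y \<in> ?C" using y gh by blast
      show "(g has_derivative g' y) (at y)" by (rule dg(1)[OF yV])
      have bij: "bij (?h' (g y))" using dg(3)[OF yV] by (simp add: H)
      have g'y: "g' y = inv (?h' (g y))" using dg(2)[OF yV] by (simp add: H)
      have "linear (g' y)" using dg(1)[OF yV] by (rule has_derivative_linear)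
      \<comment> \<open>By the chain rule the two Jacobians multiply to 1, and the one of
        \<open>?h\<close> exceeds \<open>d / 2\<close> on the ball.\<close>
      then have "matrix (g' y) ** matrix (?h' (g y)) = matrix (g' y \<circ> ?h' (g y))"
        using lin by (intro matrix_compose[symmetric]) auto
      also have "g' y \<circ> ?h' (g y) = id"
        using bij by (simp add: g'y bij_is_inj)
      finally have "det (matrix (g' y)) * det (matrix (?h' (g y))) = 1"
        by (metis det_I det_mul matrix_id_mat_1)
      then have "\<bar>det (matrix (g' y))\<bar> * \<bar>det (matrix (?h' (g y)))\<bar> = 1"
        by (metis abs_mult abs_one)
      then have "\<bar>det (matrix (g' y))\<bar> = 1 / \<bar>det (matrix (?h' (g y)))\<bar>"
        by (metis nonzero_eq_divide_eq mult_zero_right zero_neq_one)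
      also have "\<dots> \<le> 1 / (d / 2)"
        using detC[OF gy] det by (intro divide_left_mono mult_pos_pos) auto
      finally show "\<bar>det (matrix (g' y))\<bar> \<le> 2 / d" by simp
    qed (use det in auto)
    then have "ennreal (d / 2) * emeasure lborel ?C
        \<le> ennreal (d / 2) * (ennreal (2 / d) * emeasure lborel (?h ` ?C))"
      unfolding gh by (rule mult_left_mono) simp
    also have "\<dots> = emeasure lborel (?h ` ?C)"
      using det by (simp add: mult.assoc[symmetric] ennreal_mult[symmetric])
    finally show "ennreal (d / 2) * emeasure lborel ?C \<le> emeasure lborel (?h ` ?C)" .
  qed (use e1 e2 in auto)
qed

section \<open>Gaussian coefficients\<close>

abbreviation std_normal :: "real measure" where
  "std_normal \<equiv> density lborel (\<lambda>t. ennreal (std_normal_density t))"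

definition gauss :: "(real^'m) measure" where
  "gauss = density lborel (\<lambda>x. ennreal (\<Prod>i\<in>UNIV. std_normal_density (x $ i)))"

lemma sets_gauss [measurable_cong, simp]: "sets gauss = sets borel"
  by (simp add: gauss_def)

lemma space_gauss [simp]: "space gauss = UNIV"
  by (simp add: gauss_def)

lemma nn_integral_lborel_cart_prod:
  fixes g :: "'m::finite \<Rightarrow> real \<Rightarrow> ennreal"
  assumes [measurable]: "\<And>i. g i \<in> borel_measurable borel"
  shows "(\<integral>\<^sup>+x. (\<Prod>i\<in>UNIV. g i (x $ i)) \<partial>(lborel :: (real^'m) measure)) = (\<Prod>i\<in>UNIV. \<integral>\<^sup>+t. g i t \<partial>lborel)"
proof -
  let ?a = "\<lambda>i::'m. axis i (1::real)"
  have inj: "inj ?a" by (auto simp: inj_def axis_eq_axis)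
  have "(\<integral>\<^sup>+x. (\<Prod>i\<in>UNIV. g i (x $ i)) \<partial>(lborel :: (real^'m) measure))
      = (\<integral>\<^sup>+x. (\<Prod>b\<in>Basis. g (inv ?a b) (x \<bullet> b)) \<partial>lborel)"
    by (simp add: prod_Basis_cart inv_f_f[OF inj] inner_axis)
  also have "\<dots> = (\<Prod>b\<in>(Basis::(real^'m) set). \<integral>\<^sup>+t. g (inv ?a b) t \<partial>lborel)"
    by (rule nn_integral_lborel_prod) auto
  finally show ?thesis
    by (simp add: prod_Basis_cart inv_f_f[OF inj])
qed

lemma nn_integral_gauss_prod:
  fixes g :: "'m::finite \<Rightarrow> real \<Rightarrow> ennreal"
  assumes [measurable]: "\<And>i. g i \<in> borel_measurable borel"
  shows "(\<integral>\<^sup>+x. (\<Prod>i\<in>UNIV. g i (x $ i)) \<partial>(gauss :: (real^'m) measure)) = (\<Prod>i\<in>UNIV. \<integral>\<^sup>+t. g i t \<partial>std_normal)"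
proof -
  have "(\<integral>\<^sup>+x. (\<Prod>i\<in>UNIV. g i (x $ i)) \<partial>(gauss :: (real^'m) measure))
      = (\<integral>\<^sup>+x. (\<Prod>i\<in>UNIV. ennreal (std_normal_density (x $ i)) * g i (x $ i)) \<partial>(lborel :: (real^'m) measure))"
    unfolding gauss_def
    by (subst nn_integral_density) (auto simp: prod.distrib prod_ennreal)
  also have "\<dots> = (\<Prod>i\<in>UNIV. \<integral>\<^sup>+t. ennreal (std_normal_density t) * g i t \<partial>lborel)"
    by (rule nn_integral_lborel_cart_prod) auto
  finally show ?thesis
    by (simp add: nn_integral_density)
qed

text \<open>The indicator of a product set is a product of one-dimensional indicators, so the
  integral factorises.\<close>

lemma emeasure_gauss_box:
  fixes E :: "'m::finite \<Rightarrow> real set"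
  assumes [measurable]: "\<And>i. E i \<in> sets borel"
  shows "emeasure (gauss :: (real^'m) measure) {x. \<forall>i. x $ i \<in> E i} = (\<Prod>i\<in>UNIV. emeasure std_normal (E i))"
proof -
  have eq: "indicator {x. \<forall>i. x $ i \<in> E i} x = (\<Prod>i\<in>UNIV. indicator (E i) (x $ i) :: ennreal)" for x :: "real^'m"
    by (auto simp: indicator_def)
  have [measurable]: "{x :: real^'m. \<forall>i. x $ i \<in> E i} \<in> sets borel"
    by measurable
  have "emeasure (gauss :: (real^'m) measure) {x. \<forall>i. x $ i \<in> E i}
      = (\<integral>\<^sup>+x. indicator {x. \<forall>i. x $ i \<in> E i} x \<partial>(gauss :: (real^'m) measure))"
    by simp
  also have "\<dots> = (\<Prod>i\<in>UNIV. \<integral>\<^sup>+t. indicator (E i) t \<partial>std_normal)"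
    unfolding eq by (rule nn_integral_gauss_prod) auto
  finally show ?thesis
    by simp
qed

lemma prob_space_gauss: "prob_space gauss"
proof
  show "emeasure (gauss :: (real^'m) measure) (space gauss) = 1"
    using emeasure_gauss_box[of "\<lambda>_::'m. UNIV"] prob_space.emeasure_space_1[OF prob_space_normal_density[of 1 0]]
    by simp
qed

lemma prob_space_std_normal: "prob_space std_normal"
  using prob_space_normal_density[of 1 0] by simp

interpretation gauss: prob_space gauss
  by (rule prob_space_gauss)

interpretation gauss_PiM: product_prob_space "\<lambda>_. gauss" I for I
  by unfold_locales

section \<open>The law of the coefficient matrix\<close>

lemma indep_vars_rect:
  assumes M: "prob_space M" and I: "finite I"
    and indep: "prob_space.indep_vars M (\<lambda>_. borel) \<xi> I"
    and dist: "\<And>a. a \<in> I \<Longrightarrow> distributed M lborel (\<xi> a) (\<lambda>t. ennreal (std_normal_density t))"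
    and E: "\<And>a. a \<in> I \<Longrightarrow> E a \<in> sets borel"
  shows "emeasure M {w \<in> space M. \<forall>a\<in>I. \<xi> a w \<in> E a} = (\<Prod>a\<in>I. emeasure std_normal (E a))"
proof -
  interpret M: prob_space M by fact
  have rv[measurable]: "\<xi> a \<in> borel_measurable M" if "a \<in> I" for a
    using distributed_measurable[OF dist[OF that]] by simp
  show ?thesis
  \<comment> \<open>The product rule for independent events is available for nonempty index sets
    only.\<close>
  proof (cases "I = {}")
    case True
    then show ?thesis by (simp add: M.emeasure_space_1)
  next
    case False
    have "{w \<in> space M. \<forall>a\<in>I. \<xi> a w \<in> E a} = (\<Inter>a\<in>I. \<xi> a -` E a \<inter> space M)"
      using False by auto
    then have "emeasure M {w \<in> space M. \<forall>a\<in>I. \<xi> a w \<in> E a}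
        = ennreal (M.prob (\<Inter>a\<in>I. \<xi> a -` E a \<inter> space M))"
      by (simp add: M.emeasure_eq_measure)
    also have "M.prob (\<Inter>a\<in>I. \<xi> a -` E a \<inter> space M) = (\<Prod>a\<in>I. M.prob (\<xi> a -` E a \<inter> space M))"
      using M.indep_varsD[OF indep False I subset_refl] E by simp
    also have "ennreal \<dots> = (\<Prod>a\<in>I. emeasure M (\<xi> a -` E a \<inter> space M))"
      by (simp add: prod_ennreal M.emeasure_eq_measure)
    also have "\<dots> = (\<Prod>a\<in>I. emeasure std_normal (E a))"
    proof (rule prod.cong[OF refl])
      fix a assume a: "a \<in> I"
      have "emeasure M (\<xi> a -` E a \<inter> space M) = emeasure (distr M lborel (\<xi> a)) (E a)"
        using rv[OF a] E[OF a] by (simp add: emeasure_distr)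
      then show "emeasure M (\<xi> a -` E a \<inter> space M) = emeasure std_normal (E a)"
        using distributed_distr_eq_density[OF dist[OF a]] by simp
    qed
    finally show ?thesis .
  qed
qed

text \<open>The coefficient matrix of the system, grouped by exponents: the column of
  \<open>a\<close> collects its coefficients in all m copies. The restriction to \<open>I\<close>
  places the result in the space of a product measure.\<close>

definition columns :: "'a set \<Rightarrow> ('a \<Rightarrow> 'w \<Rightarrow> real) \<Rightarrow> ('m \<Rightarrow> 'w) \<Rightarrow> 'a \<Rightarrow> real^'m" where
  "columns I \<xi> \<omega> = (\<lambda>a\<in>I. \<chi> i. \<xi> a (\<omega> i))"

lemma borel_measurable_vec_lambda:
  fixes f :: "'m::finite \<Rightarrow> 'w \<Rightarrow> real"
  assumes [measurable]: "\<And>i. f i \<in> borel_measurable M"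
  shows "(\<lambda>w. \<chi> i. f i w) \<in> borel_measurable M"
proof -
  have "(\<lambda>w. (\<chi> i. f i w) \<bullet> b) \<in> borel_measurable M" if "b \<in> Basis" for b
    using that by (auto simp: Basis_vec_def inner_axis)
  then show ?thesis
    by (subst borel_measurable_euclidean_space) auto
qed

lemma measurable_columns:
  assumes "\<And>a. a \<in> I \<Longrightarrow> \<xi> a \<in> borel_measurable M"
  shows "columns I \<xi> \<in> (\<Pi>\<^sub>M i\<in>(UNIV::'m::finite set). M) \<rightarrow>\<^sub>M (\<Pi>\<^sub>M a\<in>I. borel)"
  unfolding columns_def
proof (rule measurable_restrict, rule borel_measurable_vec_lambda)
  fix a :: 'a and i :: 'm assume "a \<in> I"
  note [measurable] = assms[OF this]
  show "(\<lambda>\<omega>. \<xi> a (\<omega> i)) \<in> borel_measurable (\<Pi>\<^sub>M i\<in>UNIV. M)"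
    by measurable
qed

text \<open>The matrix entries are independent standard normals, across copies by the product
  measure and across exponents by \<open>indep\<close>. Grouping the same entries by exponent
  instead of by copy gives independent Gaussian vectors.\<close>

lemma distr_columns:
  fixes \<xi> :: "'a \<Rightarrow> 'w \<Rightarrow> real"
  assumes M: "prob_space M" and I: "finite I"
    and indep: "prob_space.indep_vars M (\<lambda>_. borel) \<xi> I"
    and dist: "\<And>a. a \<in> I \<Longrightarrow> distributed M lborel (\<xi> a) (\<lambda>t. ennreal (std_normal_density t))"
  shows "distr (\<Pi>\<^sub>M i\<in>(UNIV::'m::finite set). M) (\<Pi>\<^sub>M a\<in>I. borel) (columns I \<xi>) = (\<Pi>\<^sub>M a\<in>I. gauss)"
proof -
  let ?P = "\<Pi>\<^sub>M i\<in>(UNIV::'m set). M"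
  let ?G = "\<Pi>\<^sub>M a\<in>I. (gauss :: (real^'m) measure)"
  let ?R = "\<Pi>\<^sub>M a\<in>I. (borel :: (real^'m) measure)"
  let ?B = "\<Pi>\<^sub>M k\<in>(UNIV::'m set) \<times> I. (borel :: real measure)"
  let ?N = "\<Pi>\<^sub>M k\<in>(UNIV::'m set) \<times> I. std_normal"
  interpret M: prob_space M by fact
  interpret PP: product_prob_space "\<lambda>_::'m. M" UNIV
    by unfold_locales
  interpret N: prob_space std_normal by (rule prob_space_std_normal)
  interpret PN: product_prob_space "\<lambda>_::'m \<times> 'a. std_normal" "UNIV \<times> I"
    by unfold_locales
  \<comment> \<open>Both laws are determined by rectangles only after splitting each column into its entries.\<close>
  define T where "T v = (\<lambda>(i,a)\<in>(UNIV::'m set)\<times>I. (v a :: real^'m) $ i)" for v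
  define S where "S r = (\<lambda>a\<in>I. \<chi> i. (r (i::'m,a) :: real))" for r
  have rv: "\<xi> a \<in> borel_measurable M" if "a \<in> I" for a
    using distributed_measurable[OF dist[OF that]] by simp
  have setsR: "sets ?R = sets ?G"
    by (rule sets_PiM_cong) auto
  have setsB: "sets ?B = sets ?N"
    by (rule sets_PiM_cong) auto
  have C[measurable]: "columns I \<xi> \<in> ?P \<rightarrow>\<^sub>M ?R"
    by (rule measurable_columns[OF rv])
  have T[measurable]: "T \<in> ?R \<rightarrow>\<^sub>M ?B"
    unfolding T_def case_prod_beta'
  proof (rule measurable_restrict)
    fix k :: "'m \<times> 'a" assume "k \<in> UNIV \<times> I"
    then have 1: "(\<lambda>v. v (snd k)) \<in> ?R \<rightarrow>\<^sub>M borel"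
      by (auto intro: measurable_component_singleton)
    have 2: "(\<lambda>x :: real^'m. x $ fst k) \<in> borel_measurable borel"
      by measurable
    show "(\<lambda>v. v (snd k) $ fst k) \<in> borel_measurable ?R"
      by (rule measurable_compose[OF 1 2])
  qed
  have S[measurable]: "S \<in> ?B \<rightarrow>\<^sub>M ?R"
    unfolding S_def
    by (intro measurable_restrict borel_measurable_vec_lambda) (auto intro!: measurable_component_singleton)
  have ST: "S (T v) = v" if "v \<in> extensional I" for v
    using that by (auto simp: S_def T_def fun_eq_iff extensional_def)
  have 1: "distr (distr ?P ?R (columns I \<xi>)) ?B T = ?N"
  proof (rule PN.PiM_eqI)
    fix E :: "'m \<times> 'a \<Rightarrow> real set"
    assume "\<And>k. k \<in> UNIV \<times> I \<Longrightarrow> E k \<in> sets std_normal"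
    then have E: "E (i, a) \<in> sets borel" if "a \<in> I" for i a using that by simp
    have ES: "Pi\<^sub>E (UNIV \<times> I) E \<in> sets ?B"
      using E I by (auto intro!: sets_PiM_I_finite)
    have "emeasure (distr (distr ?P ?R (columns I \<xi>)) ?B T) (Pi\<^sub>E (UNIV \<times> I) E)
        = emeasure ?P ((\<lambda>\<omega>. T (columns I \<xi> \<omega>)) -` Pi\<^sub>E (UNIV \<times> I) E \<inter> space ?P)"
      using ES by (simp add: distr_distr emeasure_distr comp_def)
    also have "(\<lambda>\<omega>. T (columns I \<xi> \<omega>)) -` Pi\<^sub>E (UNIV \<times> I) E \<inter> space ?P
        = Pi\<^sub>E UNIV (\<lambda>i. {w \<in> space M. \<forall>a\<in>I. \<xi> a w \<in> E (i, a)})"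
      by (auto simp: T_def columns_def space_PiM PiE_iff extensional_def split: if_splits)
    also have "emeasure ?P \<dots> = (\<Prod>i\<in>UNIV. emeasure M {w \<in> space M. \<forall>a\<in>I. \<xi> a w \<in> E (i, a)})"
    proof (rule PP.emeasure_PiM)
      fix i :: 'm
      have "{w \<in> space M. \<xi> a w \<in> E (i, a)} \<in> sets M" if "a \<in> I" for a
        using measurable_sets[OF rv[OF that] E[OF that, of i]] by (simp add: vimage_def Int_def conj_commute)
      then show "{w \<in> space M. \<forall>a\<in>I. \<xi> a w \<in> E (i, a)} \<in> sets M"
        using I by (rule sets.sets_Collect_finite_All)
    qed simp
    also have "\<dots> = (\<Prod>i\<in>UNIV. \<Prod>a\<in>I. emeasure std_normal (E (i, a)))"
      using indep_vars_rect[OF M I indep dist] E by simp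
    also have "\<dots> = (\<Prod>k\<in>UNIV \<times> I. emeasure std_normal (E k))"
      by (simp add: prod.cartesian_product)
    finally show "emeasure (distr (distr ?P ?R (columns I \<xi>)) ?B T) (Pi\<^sub>E (UNIV \<times> I) E)
        = (\<Prod>k\<in>UNIV \<times> I. emeasure std_normal (E k))" .
  qed (use I setsB in auto)
  have 2: "distr ?G ?B T = ?N"
  proof (rule PN.PiM_eqI)
    fix E :: "'m \<times> 'a \<Rightarrow> real set"
    assume "\<And>k. k \<in> UNIV \<times> I \<Longrightarrow> E k \<in> sets std_normal"
    then have E: "E (i, a) \<in> sets borel" if "a \<in> I" for i a using that by simp
    have ES: "Pi\<^sub>E (UNIV \<times> I) E \<in> sets ?B"
      using E I by (auto intro!: sets_PiM_I_finite)
    have TG: "T \<in> ?G \<rightarrow>\<^sub>M ?B"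
      using T by (simp only: measurable_cong_sets[OF setsR refl])
    have "emeasure (distr ?G ?B T) (Pi\<^sub>E (UNIV \<times> I) E) = emeasure ?G (T -` Pi\<^sub>E (UNIV \<times> I) E \<inter> space ?G)"
      using ES TG by (simp add: emeasure_distr)
    also have "T -` Pi\<^sub>E (UNIV \<times> I) E \<inter> space ?G = Pi\<^sub>E I (\<lambda>a. {x. \<forall>i. x $ i \<in> E (i, a)})"
      by (auto simp: T_def space_PiM PiE_iff extensional_def split: if_splits)
    also have "emeasure ?G \<dots> = (\<Prod>a\<in>I. emeasure gauss {x :: real^'m. \<forall>i. x $ i \<in> E (i, a)})"
    proof (rule gauss_PiM.emeasure_PiM[OF I])
      fix a assume "a \<in> I"
      note [measurable] = E[OF this]
      show "{x :: real^'m. \<forall>i. x $ i \<in> E (i, a)} \<in> sets gauss"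
        unfolding sets_gauss by measurable
    qed
    also have "\<dots> = (\<Prod>a\<in>I. \<Prod>i\<in>UNIV. emeasure std_normal (E (i, a)))"
      using E by (simp add: emeasure_gauss_box)
    also have "\<dots> = (\<Prod>k\<in>UNIV \<times> I. emeasure std_normal (E k))"
      by (subst prod.swap) (simp add: prod.cartesian_product)
    finally show "emeasure (distr ?G ?B T) (Pi\<^sub>E (UNIV \<times> I) E) = (\<Prod>k\<in>UNIV \<times> I. emeasure std_normal (E k))" .
  qed (use I setsB in auto)
  \<comment> \<open>Since \<open>S\<close> undoes \<open>T\<close> on the relevant space, laws with
    the same image under \<open>T\<close> coincide.\<close>
  have inv: "distr (distr Q ?B T) ?R S = Q" if Q: "sets Q = sets ?R" for Q
  proof -
    have [measurable]: "T \<in> Q \<rightarrow>\<^sub>M ?B"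
      using T by (simp only: measurable_cong_sets[OF Q refl])
    have "distr (distr Q ?B T) ?R S = distr Q ?R (\<lambda>v. S (T v))"
      by (simp add: distr_distr comp_def)
    also have "\<dots> = distr Q Q (\<lambda>v. v)"
      using sets_eq_imp_space_eq[OF Q]
      by (intro distr_cong) (auto simp: Q ST space_PiM PiE_def)
    finally show ?thesis by simp
  qed
  have "distr ?P ?R (columns I \<xi>) = distr (distr (distr ?P ?R (columns I \<xi>)) ?B T) ?R S"
    by (simp add: inv)
  also have "\<dots> = distr (distr ?G ?B T) ?R S"
    by (simp only: 1 2)
  also have "\<dots> = ?G"
    by (rule inv) (simp add: setsR)
  finally show ?thesis .
qed

section \<open>Zero sets as functions of the coefficient matrix\<close>

text \<open>The m scalar equations are written as one vector equation in the columns, with the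
  randomness replaced by a free parameter \<open>v\<close>.\<close>

definition zero_set :: "(real^'m) set \<Rightarrow> (real^'m \<Rightarrow> real) \<Rightarrow> (real^'m \<Rightarrow> real^'m) \<Rightarrow> (real^'m) set" where
  "zero_set I \<beta> v = {x. (\<Sum>a\<in>I. (\<beta> a * exp (a \<bullet> x)) *\<^sub>R v a) = 0}"

lemma exp_sum_zeros_eq:
  "{x \<in> U. \<forall>i. exp_sum I \<xi> \<beta> (\<omega> i) x = 0} = U \<inter> zero_set I \<beta> (columns I \<xi> \<omega>)"
  by (auto simp: zero_set_def exp_sum_def columns_def vec_eq_iff sum_component mult.commute mult.left_commute
        cong: sum.cong)

context
  fixes M :: "'w measure" and I :: "(real^'m) set" and \<xi> :: "real^'m \<Rightarrow> 'w \<Rightarrow> real"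
  assumes M: "prob_space M" and I: "finite I"
    and indep: "prob_space.indep_vars M (\<lambda>_. borel) \<xi> I"
    and dist: "\<And>a. a \<in> I \<Longrightarrow> distributed M lborel (\<xi> a) (\<lambda>t. ennreal (std_normal_density t))"
begin

lemma nn_integral_columns:
  assumes F: "F \<in> borel_measurable (\<Pi>\<^sub>M a\<in>I. borel)"
  shows "(\<integral>\<^sup>+\<omega>. F (columns I \<xi> \<omega>) \<partial>(\<Pi>\<^sub>M i\<in>(UNIV::'m set). M)) = (\<integral>\<^sup>+v. F v \<partial>(\<Pi>\<^sub>M a\<in>I. gauss))"
proof -
  have "columns I \<xi> \<in> (\<Pi>\<^sub>M i\<in>(UNIV::'m::finite set). M) \<rightarrow>\<^sub>M (\<Pi>\<^sub>M a\<in>I. borel)"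
    using distributed_measurable[OF dist] by (intro measurable_columns) simp
  from nn_integral_distr[OF this, of F] F show ?thesis
    by (simp add: distr_columns[OF M I indep dist])
qed

text \<open>Monotonicity of \<open>nn_integral\<close> holds for arbitrary integrands, so the
  passage to the Gaussian law is made for the measurable majorant \<open>F\<close> rather than for
  the zero count.\<close>

lemma expected_zeros_le:
  assumes "F \<in> borel_measurable (\<Pi>\<^sub>M a\<in>I. borel)"
    and "\<And>v. emeasure (count_space UNIV) (U \<inter> zero_set I \<beta> v) \<le> F v"
  shows "expected_zeros M (exp_sum I \<xi> \<beta>) U \<le> (\<integral>\<^sup>+v. F v \<partial>(\<Pi>\<^sub>M a\<in>I. gauss))"
  unfolding expected_zeros_def exp_sum_zeros_eq nn_integral_columns[OF assms(1), symmetric]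
  by (intro nn_integral_mono assms)

text \<open>On the event \<open>E\<close> there is at least one zero, so the count dominates the
  indicator of \<open>E\<close>.\<close>

lemma expected_zeros_ge:
  assumes E: "E \<in> sets (\<Pi>\<^sub>M a\<in>I. borel)"
    and "\<And>v. v \<in> E \<Longrightarrow> U \<inter> zero_set I \<beta> v \<noteq> {}"
  shows "emeasure (\<Pi>\<^sub>M a\<in>I. gauss) E \<le> expected_zeros M (exp_sum I \<xi> \<beta>) U"
proof -
  have "sets (\<Pi>\<^sub>M a\<in>I. gauss) = sets (\<Pi>\<^sub>M a\<in>I. borel)"
    by (rule sets_PiM_cong) auto
  then have "emeasure (\<Pi>\<^sub>M a\<in>I. gauss) E = (\<integral>\<^sup>+v. indicator E v \<partial>(\<Pi>\<^sub>M a\<in>I. gauss))"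
    using E by simp
  also have "\<dots> = (\<integral>\<^sup>+\<omega>. indicator E (columns I \<xi> \<omega>) \<partial>(\<Pi>\<^sub>M i\<in>(UNIV::'m set). M))"
    using E by (intro nn_integral_columns[symmetric]) simp
  also have "\<dots> \<le> expected_zeros M (exp_sum I \<xi> \<beta>) U"
    unfolding expected_zeros_def exp_sum_zeros_eq
  proof (rule nn_integral_mono)
    fix \<omega> :: "'m \<Rightarrow> 'w"
    show "indicator E (columns I \<xi> \<omega>) \<le> emeasure (count_space UNIV) (U \<inter> zero_set I \<beta> (columns I \<xi> \<omega>))"
    proof (cases "columns I \<xi> \<omega> \<in> E")
      case True
      then obtain x where x: "x \<in> U \<inter> zero_set I \<beta> (columns I \<xi> \<omega>)"
        using assms(2) by blast
      then have "emeasure (count_space UNIV) {x} \<le> emeasure (count_space UNIV) (U \<inter> zero_set I \<beta> (columns I \<xi> \<omega>))"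
        by (intro emeasure_mono) auto
      then show ?thesis
        using True by simp
    qed simp
  qed
  finally show ?thesis .
qed

end

text \<open>On a compact set a continuous function vanishes somewhere iff its norm becomes
  arbitrarily small on a countable dense subset. This replaces the uncountable existential by
  countable set operations.\<close>

lemma pred_zero_in_compact:
  assumes C: "compact C"
  shows "Measurable.pred (\<Pi>\<^sub>M a\<in>I. borel) (\<lambda>v. C \<inter> zero_set I \<beta> v \<noteq> {})"
proof -
  obtain D where D: "countable D" "D \<subseteq> C" "C \<subseteq> closure D"
    using separable .
  define g where "g v x = (\<Sum>a\<in>I. (\<beta> a * exp (a \<bullet> x)) *\<^sub>R v a)" for v :: "real^'a \<Rightarrow> real^'a" and x
  have contg: "continuous_on S (g v)" for S v
    unfolding g_def by (intro continuous_intros)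
  have "C \<inter> zero_set I \<beta> v \<noteq> {} \<longleftrightarrow> (\<forall>n::nat. \<exists>x\<in>D. norm (g v x) < 1 / real (Suc n))" for v
  proof
    assume "C \<inter> zero_set I \<beta> v \<noteq> {}"
    then obtain x where x: "x \<in> C" "g v x = 0"
      by (auto simp: zero_set_def g_def)
    show "\<forall>n::nat. \<exists>x\<in>D. norm (g v x) < 1 / real (Suc n)"
    proof
      fix n :: nat
      have "isCont (g v) x"
        using contg[of UNIV v] by (simp add: continuous_on_eq_continuous_at)
      then obtain d where d: "d > 0" "\<And>y. dist y x < d \<Longrightarrow> dist (g v y) (g v x) < 1 / real (Suc n)"
        unfolding continuous_at_eps_delta by (metis of_nat_0_less_iff zero_less_Suc zero_less_divide_1_iff)
      moreover obtain y where "y \<in> D" "dist y x < d"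
        using D(3) x(1) d(1) closure_approachable by blast
      ultimately show "\<exists>x\<in>D. norm (g v x) < 1 / real (Suc n)"
        using x(2) by (auto simp: dist_norm)
    qed
  next
    assume small: "\<forall>n::nat. \<exists>x\<in>D. norm (g v x) < 1 / real (Suc n)"
    then have "C \<noteq> {}" using D(2) by blast
    then obtain x where x: "x \<in> C" "\<And>y. y \<in> C \<Longrightarrow> norm (g v x) \<le> norm (g v y)"
      using continuous_attains_inf[OF C, of "\<lambda>x. norm (g v x)"] contg[of C v]
      by (auto intro: continuous_on_norm)
    have "norm (g v x) = 0"
    proof (rule ccontr)
      assume "norm (g v x) \<noteq> 0"
      then obtain n where "1 / real (Suc n) < norm (g v x)"
        using nat_approx_posE[of "norm (g v x)"] by auto
      then show False
        using small x(2) D(2) by (metis less_trans not_less subsetD)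
    qed
    then show "C \<inter> zero_set I \<beta> v \<noteq> {}"
      using x(1) by (auto simp: zero_set_def g_def)
  qed
  moreover have "Measurable.pred (\<Pi>\<^sub>M a\<in>I. borel) (\<lambda>v. \<forall>n::nat. \<exists>x\<in>D. norm (g v x) < 1 / real (Suc n))"
  proof -
    have [measurable]: "(\<lambda>v. g v x) \<in> borel_measurable (\<Pi>\<^sub>M a\<in>I. borel)" for x
      unfolding g_def by measurable
    have "Measurable.pred (\<Pi>\<^sub>M a\<in>I. borel) (\<lambda>v. \<exists>x\<in>D. norm (g v x) < 1 / real (Suc n))" for n :: nat
    proof -
      have eq: "{v \<in> space (\<Pi>\<^sub>M a\<in>I. borel). \<exists>x\<in>D. norm (g v x) < 1 / real (Suc n)}
          = (\<Union>x\<in>D. {v \<in> space (\<Pi>\<^sub>M a\<in>I. borel). norm (g v x) < 1 / real (Suc n)})" by auto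
      show ?thesis
        unfolding pred_def eq using D(1) by (intro sets.countable_UN'') measurable
    qed
    then show ?thesis by measurable
  qed
  ultimately show ?thesis by simp
qed

lemma fsigma_compactE:
  fixes Q :: "(real^'m) set"
  assumes "fsigma Q"
  obtains C :: "nat \<Rightarrow> (real^'m) set" where "\<forall>n. compact (C n)" "Q = (\<Union>n. C n)"
proof -
  obtain C :: "nat \<Rightarrow> (real^'m) set" where C: "range C \<subseteq> Collect compact" "Q = \<Union>(range C)"
    using assms by (auto simp: fsigma_Union_compact)
  show thesis
    by (rule that[of C]) (use C in auto)
qed

lemma pred_zero_in_fsigma:
  fixes Q :: "(real^'m) set"
  assumes "fsigma Q"
  shows "Measurable.pred (\<Pi>\<^sub>M a\<in>I. borel) (\<lambda>v. Q \<inter> zero_set I \<beta> v \<noteq> {})"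
proof -
  obtain C :: "nat \<Rightarrow> (real^'m) set" where C: "\<forall>n. compact (C n)" "Q = (\<Union>n. C n)"
    using assms by (rule fsigma_compactE)
  have "Q \<inter> zero_set I \<beta> v \<noteq> {} \<longleftrightarrow> (\<exists>n. C n \<inter> zero_set I \<beta> v \<noteq> {})" for v
    using C(2) by auto
  then show ?thesis
    using pred_zero_in_compact[OF C(1)[rule_format]] by simp
qed

section \<open>Integrating out the column of the pivot\<close>

text \<open>Divide the vector equation by the positive factor
  \<open>\<beta> p * exp (p \<bullet> x)\<close> and solve for the column \<open>y\<close> of the
  pivot.\<close>

lemma zero_set_pivot:
  assumes J: "finite J" "p \<notin> J" and p: "\<beta> p > 0"
  shows "x \<in> zero_set (insert p J) \<beta> (w(p := y)) \<longleftrightarrow> y = pivot_map \<beta> p J (\<lambda>a. - w a) x"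
proof -
  let ?c = "\<beta> p * exp (p \<bullet> x)"
  have "(\<Sum>a\<in>J. (\<beta> a * exp (a \<bullet> x)) *\<^sub>R (w(p := y)) a) = ?c *\<^sub>R (\<Sum>a\<in>J. pivot_coeff \<beta> p x a *\<^sub>R w a)"
    unfolding scaleR_sum_right
  proof (rule sum.cong[OF refl])
    fix a assume "a \<in> J"
    then have "a \<noteq> p" using J by auto
    moreover have "?c * pivot_coeff \<beta> p x a = \<beta> a * exp (a \<bullet> x)"
      using p by (simp add: pivot_coeff_def inner_diff_left exp_diff)
    ultimately show "(\<beta> a * exp (a \<bullet> x)) *\<^sub>R (w(p := y)) a = ?c *\<^sub>R pivot_coeff \<beta> p x a *\<^sub>R w a"
      by simp
  qed
  also have "\<dots> = - (?c *\<^sub>R pivot_map \<beta> p J (\<lambda>a. - w a) x)"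
    by (simp add: pivot_map_def sum_negf)
  finally have "x \<in> zero_set (insert p J) \<beta> (w(p := y))
      \<longleftrightarrow> ?c *\<^sub>R y - ?c *\<^sub>R pivot_map \<beta> p J (\<lambda>a. - w a) x = 0"
    using J by (simp add: zero_set_def)
  also have "\<dots> \<longleftrightarrow> y = pivot_map \<beta> p J (\<lambda>a. - w a) x"
    using p by simp
  finally show ?thesis .
qed

lemma sets_PiM_gauss: "sets (\<Pi>\<^sub>M a\<in>I. gauss) = sets (\<Pi>\<^sub>M a\<in>I. borel)"
  by (rule sets_PiM_cong) auto

text \<open>Continuous images of compact sets are compact, so countable unions of compact sets have
  Borel images. This is why the cells below are taken to be \<open>fsigma\<close> rather than merely
  Borel.\<close>

lemma borel_image_fsigma:
  fixes Q :: "(real^'m) set"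
  assumes "fsigma Q"
  shows "Q \<in> sets borel" "pivot_map \<beta> p J w ` Q \<in> sets borel"
proof -
  obtain C :: "nat \<Rightarrow> (real^'m) set" where C: "\<forall>n. compact (C n)" "Q = (\<Union>n. C n)"
    using assms by (rule fsigma_compactE)
  show "Q \<in> sets borel"
  proof -
    have "C n \<in> sets borel" for n
      using C(1) by (simp add: borel_closed compact_imp_closed)
    then show ?thesis unfolding C(2) by auto
  qed
  have "pivot_map \<beta> p J w ` C n \<in> sets borel" for n
    by (intro borel_closed compact_imp_closed compact_continuous_image continuous_on_pivot_map C(1)[rule_format])
  then show "pivot_map \<beta> p J w ` Q \<in> sets borel"
    unfolding C(2) image_UN by auto
qed

text \<open>Fubini with the column of \<open>p\<close> integrated first: for fixed other columns
  \<open>w\<close>, a zero in \<open>Q\<close> exists iff this column lies in the image of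
  \<open>Q\<close> under the pivot map.\<close>

lemma
  fixes Q :: "(real^'m) set"
  assumes J: "finite J" "p \<notin> J" and p: "\<beta> p > 0" and Q: "fsigma Q"
  shows measurable_gauss_image:
      "(\<lambda>w. emeasure gauss (pivot_map \<beta> p J (\<lambda>a. - w a) ` Q)) \<in> borel_measurable (\<Pi>\<^sub>M a\<in>J. gauss)"
    and nn_integral_zero_exists:
      "(\<integral>\<^sup>+v. of_bool (Q \<inter> zero_set (insert p J) \<beta> v \<noteq> {}) \<partial>(\<Pi>\<^sub>M a\<in>insert p J. gauss))
        = (\<integral>\<^sup>+w. emeasure gauss (pivot_map \<beta> p J (\<lambda>a. - w a) ` Q) \<partial>(\<Pi>\<^sub>M a\<in>J. gauss))"
proof -
  define f :: "_ \<Rightarrow> ennreal" where "f v = of_bool (Q \<inter> zero_set (insert p J) \<beta> v \<noteq> {})" for v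
  have "Measurable.pred (\<Pi>\<^sub>M a\<in>insert p J. gauss) (\<lambda>v. Q \<inter> zero_set (insert p J) \<beta> v \<noteq> {})"
    using pred_zero_in_fsigma[OF Q] by (simp only: measurable_cong_sets[OF sets_PiM_gauss refl])
  then have f[measurable]: "f \<in> borel_measurable (\<Pi>\<^sub>M a\<in>insert p J. gauss)"
    unfolding f_def of_bool_def by measurable
  have inner: "(\<integral>\<^sup>+y. f (w(p := y)) \<partial>gauss) = emeasure gauss (pivot_map \<beta> p J (\<lambda>a. - w a) ` Q)" for w
  proof -
    have "f (w(p := y)) = indicator (pivot_map \<beta> p J (\<lambda>a. - w a) ` Q) y" for y
      using zero_set_pivot[of J p \<beta>, OF J p] by (auto simp: f_def indicator_def)
    then show ?thesis
      using borel_image_fsigma(2)[OF Q] by simp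
  qed
  have "(\<lambda>w. \<integral>\<^sup>+y. f (w(p := y)) \<partial>gauss) \<in> borel_measurable (\<Pi>\<^sub>M a\<in>J. gauss)"
    by measurable
  then show "(\<lambda>w. emeasure gauss (pivot_map \<beta> p J (\<lambda>a. - w a) ` Q)) \<in> borel_measurable (\<Pi>\<^sub>M a\<in>J. gauss)"
    by (simp only: inner)
  show "(\<integral>\<^sup>+v. of_bool (Q \<inter> zero_set (insert p J) \<beta> v \<noteq> {}) \<partial>(\<Pi>\<^sub>M a\<in>insert p J. gauss))
        = (\<integral>\<^sup>+w. emeasure gauss (pivot_map \<beta> p J (\<lambda>a. - w a) ` Q) \<partial>(\<Pi>\<^sub>M a\<in>J. gauss))"
    using gauss_PiM.product_nn_integral_insert[OF J f] unfolding inner unfolding f_def .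
qed

definition coeff_moment :: "(real^'m) set \<Rightarrow> ennreal" where
  "coeff_moment J = (\<integral>\<^sup>+w. ennreal (coeff_bound J w) \<partial>(\<Pi>\<^sub>M a\<in>J. gauss))"

text \<open>By independence the integral factorises into powers of the expectation of
  \<open>1 + \<bar>t\<bar>\<close>, which is finite.\<close>

lemma coeff_moment_finite:
  assumes J: "finite J"
  shows "coeff_moment J < \<infinity>"
proof -
  have 1: "(\<integral>\<^sup>+t. ennreal (1 + \<bar>t\<bar>) \<partial>std_normal) < \<infinity>"
  proof -
    have "integrable lborel (\<lambda>t. std_normal_density t * (1 + \<bar>t\<bar>))"
      using integrable_std_normal_moment_abs[of 0] integrable_std_normal_moment_abs[of 1]
      by (simp add: ring_distribs)
    then have "(\<integral>\<^sup>+t. ennreal (norm (std_normal_density t * (1 + \<bar>t\<bar>))) \<partial>lborel) < \<infinity>"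
      by (simp add: integrable_iff_bounded)
    then show ?thesis
      by (simp add: nn_integral_density abs_mult ennreal_mult)
  qed
  have [measurable]: "(\<lambda>x. \<Prod>i\<in>UNIV. ennreal (1 + \<bar>(x :: real^'a) $ i\<bar>)) \<in> borel_measurable borel"
    by measurable
  have "coeff_moment J = (\<integral>\<^sup>+w. (\<Prod>a\<in>J. \<Prod>i\<in>UNIV. ennreal (1 + \<bar>w a $ i\<bar>)) \<partial>(\<Pi>\<^sub>M a\<in>J. (gauss :: (real^'a) measure)))"
  proof -
    have "(\<Prod>a\<in>J. \<Prod>i\<in>UNIV. ennreal (1 + \<bar>w a $ i\<bar>)) = ennreal (coeff_bound J w)" for w
      unfolding coeff_bound_def by (simp add: prod_ennreal prod_nonneg del: ennreal_plus)
    then show ?thesis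
      by (simp only: coeff_moment_def)
  qed
  also have "\<dots> = (\<Prod>a\<in>J. \<integral>\<^sup>+x. (\<Prod>i\<in>UNIV. ennreal (1 + \<bar>(x :: real^'a) $ i\<bar>)) \<partial>gauss)"
    by (rule gauss_PiM.product_nn_integral_prod[OF J]) measurable
  also have "\<dots> = (\<Prod>a\<in>J. \<Prod>i\<in>(UNIV::'a set). \<integral>\<^sup>+t. ennreal (1 + \<bar>t\<bar>) \<partial>std_normal)"
    by (subst nn_integral_gauss_prod) auto
  also have "\<dots> < \<infinity>"
    using 1 by (simp add: power_less_top_ennreal)
  finally show ?thesis .
qed

text \<open>Each factor of the Gaussian density is at most 1.\<close>

lemma emeasure_gauss_le_lborel:
  assumes [measurable]: "S \<in> sets borel"
  shows "emeasure gauss S \<le> emeasure lborel S"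
proof -
  have le1: "std_normal_density t \<le> 1" for t
  proof -
    have "1 * exp (- t\<^sup>2 / 2) \<le> sqrt (2 * pi) * 1"
      using pi_ge_two by (intro mult_mono) auto
    then show ?thesis
      by (simp add: std_normal_density_def field_simps)
  qed
  have "emeasure gauss S = (\<integral>\<^sup>+x. ennreal (\<Prod>i\<in>UNIV. std_normal_density (x $ i)) * indicator S x \<partial>lborel)"
    unfolding gauss_def by (rule emeasure_density) auto
  also have "\<dots> \<le> (\<integral>\<^sup>+x. indicator S x \<partial>lborel)"
    using le1 by (intro nn_integral_mono) (auto simp: indicator_def intro!: prod_le_1)
  finally show ?thesis by simp
qed

text \<open>The Gaussian measure of the image is at most its volume, hence at most the supremum of
  the Jacobian times the volume of \<open>Q\<close>. The coefficients enter only through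
  \<open>coeff_bound\<close>, which is then averaged.\<close>

lemma nn_integral_zero_exists_le:
  fixes Q :: "(real^'m) set"
  assumes J: "finite J" "p \<notin> J" and \<beta>: "\<And>a. a \<in> insert p J \<Longrightarrow> \<beta> a > 0" and Q: "fsigma Q" "bounded Q"
    and B: "\<And>x. x \<in> Q \<Longrightarrow> pivot_bound \<beta> p J x \<le> B" "0 \<le> B"
  shows "(\<integral>\<^sup>+v. of_bool (Q \<inter> zero_set (insert p J) \<beta> v \<noteq> {}) \<partial>(\<Pi>\<^sub>M a\<in>insert p J. gauss))
    \<le> coeff_moment J * ennreal B * emeasure lborel Q"
proof -
  have cb0: "0 \<le> coeff_bound J w" for w
    unfolding coeff_bound_def by (intro prod_nonneg) auto
  have cbm: "coeff_bound J (\<lambda>a. - w a) = coeff_bound J w" for w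
    by (simp add: coeff_bound_def)
  have "emeasure gauss (pivot_map \<beta> p J (\<lambda>a. - w a) ` Q)
      \<le> ennreal (coeff_bound J w) * (ennreal B * emeasure lborel Q)" for w
  proof -
    have "emeasure gauss (pivot_map \<beta> p J (\<lambda>a. - w a) ` Q) \<le> emeasure lborel (pivot_map \<beta> p J (\<lambda>a. - w a) ` Q)"
      by (rule emeasure_gauss_le_lborel[OF borel_image_fsigma(2)[OF Q(1)]])
    also have "\<dots> \<le> ennreal (coeff_bound J w * B) * emeasure lborel Q"
    proof (rule emeasure_bounded_differentiable_image[OF borel_image_fsigma[OF Q(1)] pivot_map_has_derivative])
      fix x assume x: "x \<in> Q"
      have "\<bar>det (matrix (pivot_deriv \<beta> p J (\<lambda>a. - w a) x))\<bar> \<le> coeff_bound J w * pivot_bound \<beta> p J x"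
        using abs_det_pivot_deriv_le[OF J(1), of \<beta> p "\<lambda>a. - w a" x] \<beta> by (simp add: cbm)
      also have "\<dots> \<le> coeff_bound J w * B"
        by (intro mult_left_mono B x cb0)
      finally show "\<bar>det (matrix (pivot_deriv \<beta> p J (\<lambda>a. - w a) x))\<bar> \<le> coeff_bound J w * B" .
    qed (use cb0 B emeasure_bounded_finite[OF Q(2)] in auto)
    finally show ?thesis
      using cb0 B by (simp add: ennreal_mult mult.assoc)
  qed
  then have "(\<integral>\<^sup>+w. emeasure gauss (pivot_map \<beta> p J (\<lambda>a. - w a) ` Q) \<partial>(\<Pi>\<^sub>M a\<in>J. gauss))
      \<le> (\<integral>\<^sup>+w. ennreal (coeff_bound J w) * (ennreal B * emeasure lborel Q) \<partial>(\<Pi>\<^sub>M a\<in>J. gauss))"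
    by (intro nn_integral_mono)
  also have "\<dots> = coeff_moment J * (ennreal B * emeasure lborel Q)"
  proof -
    have "(\<lambda>w. w a $ i) \<in> borel_measurable (\<Pi>\<^sub>M a\<in>J. gauss)" if "a \<in> J" for a and i :: 'm
      by (rule measurable_compose[OF measurable_component_singleton[OF that]]) measurable
    then have "(\<lambda>w. ennreal (coeff_bound J w)) \<in> borel_measurable (\<Pi>\<^sub>M a\<in>J. gauss)"
      unfolding coeff_bound_def by measurable
    then show ?thesis
      unfolding coeff_moment_def by (rule nn_integral_multc)
  qed
  finally show ?thesis
    using \<beta> by (simp add: nn_integral_zero_exists[OF J _ Q(1)] mult.assoc)
qed

text \<open>Cells are obtained by making the balls of radius \<open>e / 2\<close> around a countable
  dense set disjoint. Each cell is an open set minus finitely many open balls, hence a countable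
  union of compact sets.\<close>

lemma small_fsigma_partition:
  fixes U :: "(real^'m) set"
  assumes U: "open U" and e: "e > 0"
  obtains Q :: "nat \<Rightarrow> (real^'m) set" where "disjoint_family Q" "(\<Union>j. Q j) = U"
    "\<And>j. fsigma (Q j)" "\<And>j. bounded (Q j)" "\<And>j x y. x \<in> Q j \<Longrightarrow> y \<in> Q j \<Longrightarrow> dist x y < e"
proof -
  obtain D :: "(real^'m) set" where D: "countable D" "\<And>X. open X \<Longrightarrow> X \<noteq> {} \<Longrightarrow> \<exists>d\<in>D. d \<in> X"
    by (erule countable_dense_setE)
  define q where "q = from_nat_into D"
  define b where "b j = ball (q j) (e / 2)" for j
  define Q where "Q j = U \<inter> disjointed b j" for j
  have Dne: "D \<noteq> {}" using D(2)[of UNIV] by auto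
  have cover: "(\<Union>j. b j) = UNIV"
  proof safe
    fix x :: "real^'m"
    obtain d where d: "d \<in> D" "d \<in> ball x (e / 2)"
      using D(2)[of "ball x (e / 2)"] e by auto
    then obtain j where "q j = d"
      using D(1) Dne unfolding q_def by (metis from_nat_into_surj)
    then show "x \<in> (\<Union>j. b j)"
      using d(2) by (auto simp: b_def dist_commute)
  qed simp
  show thesis
  proof
    show "disjoint_family Q"
      using disjoint_family_disjointed[of b] by (auto simp: disjoint_family_on_def Q_def)
    show "(\<Union>j. Q j) = U"
      using cover UN_disjointed_eq[of b] by (auto simp: Q_def)
    show sub: "bounded (Q j)" for j
      by (rule bounded_subset[OF bounded_ball[of "q j" "e / 2"]]) (use disjointed_subset[of b j] in \<open>auto simp: Q_def b_def\<close>)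
    show "dist x y < e" if "x \<in> Q j" "y \<in> Q j" for j x y
    proof (rule dist_triangle_half_r)
      show "dist (q j) x < e / 2" "dist (q j) y < e / 2"
        using that disjointed_subset[of b j] by (auto simp: Q_def b_def)
    qed
    show "fsigma (Q j)" for j
    proof -
      have "open (U \<inter> b j)" using U by (auto simp: b_def)
      then obtain C where C: "\<And>n::nat. compact (C n)" "\<Union>(range C) = U \<inter> b j"
        by (metis open_Union_compact_subsets)
      let ?K = "- (\<Union>i\<in>{0..<j}. b i)"
      have "closed ?K" by (auto simp: b_def)
      then have "compact (C n \<inter> ?K)" for n using C(1) by (rule compact_Int_closed[rotated])
      moreover have "Q j = (\<Union>n. C n \<inter> ?K)"
        using C(2) by (auto simp: Q_def disjointed_def)
      ultimately show ?thesis
        unfolding fsigma_Union_compact by (intro exI[of _ "\<lambda>n. C n \<inter> ?K"]) auto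
    qed
  qed
qed

section \<open>Counting zeros from above\<close>

text \<open>Once the mesh is below the least distance within a finite set \<open>F\<close> of zeros,
  distinct points of \<open>F\<close> lie in distinct cells, so at least \<open>card F\<close> cells
  are hit. For infinitely many zeros \<open>F\<close> can be arbitrarily large.\<close>

lemma count_le_liminf_partition:
  fixes Q :: "nat \<Rightarrow> nat \<Rightarrow> 'a::metric_space set"
  assumes Q: "\<And>n. disjoint_family (Q n)" "\<And>n. (\<Union>j. Q n j) = U"
    and small: "\<And>n j x y. x \<in> Q n j \<Longrightarrow> y \<in> Q n j \<Longrightarrow> dist x y < inverse (real (Suc n))"
  shows "emeasure (count_space UNIV) (U \<inter> Z) \<le> liminf (\<lambda>n. \<Sum>j. of_bool (Q n j \<inter> Z \<noteq> {}))"
    (is "_ \<le> ?L")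
proof -
  have fin: "of_nat (card F) \<le> ?L" if F: "finite F" "F \<subseteq> U \<inter> Z" for F
  proof -
    \<comment> \<open>The inserted 1 keeps the minimum meaningful when \<open>F\<close> has fewer
      than two points.\<close>
    define e where "e = Min (insert 1 {dist x y | x y. x \<in> F \<and> y \<in> F \<and> x \<noteq> y})"
    have finD: "finite {dist x y | x y. x \<in> F \<and> y \<in> F \<and> x \<noteq> y}"
      by (rule finite_subset[of _ "(\<lambda>(x, y). dist x y) ` (F \<times> F)"]) (use F in auto)
    have e: "e > 0"
      unfolding e_def using finD by (subst Min_gr_iff) auto
    have sep: "e \<le> dist x y" if "x \<in> F" "y \<in> F" "x \<noteq> y" for x y
      unfolding e_def using finD that by (intro Min_le) auto
    have "\<forall>\<^sub>F n in sequentially. inverse (real (Suc n)) < e"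
      using LIMSEQ_inverse_real_of_nat e by (rule order_tendstoD)
    then have "\<forall>\<^sub>F n in sequentially. of_nat (card F) \<le> (\<Sum>j. of_bool (Q n j \<inter> Z \<noteq> {}) :: ennreal)"
    proof eventually_elim
      case (elim n)
      have "\<forall>x\<in>F. \<exists>j. x \<in> Q n j" using F Q(2)[of n] by auto
      then obtain k where k: "\<And>x. x \<in> F \<Longrightarrow> x \<in> Q n (k x)" by metis
      have inj: "inj_on k F"
      proof (rule inj_onI, rule ccontr)
        fix x y assume xy: "x \<in> F" "y \<in> F" "k x = k y" "x \<noteq> y"
        then have "dist x y < inverse (real (Suc n))" using k small by metis
        then show False using sep[OF xy(1,2,4)] elim by simp
      qed
      have "of_nat (card F) = (\<Sum>j\<in>k ` F. of_bool (Q n j \<inter> Z \<noteq> {}) :: ennreal)"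
      proof -
        have "Q n j \<inter> Z \<noteq> {}" if "j \<in> k ` F" for j
          using that k F by auto
        then show ?thesis by (simp add: card_image[OF inj])
      qed
      also have "\<dots> \<le> (\<Sum>j. of_bool (Q n j \<inter> Z \<noteq> {}))"
        using F by (intro sum_le_suminf) auto
      finally show ?case .
    qed
    then show ?thesis by (rule Liminf_bounded)
  qed
  show ?thesis
  proof (cases "finite (U \<inter> Z)")
    case True
    then show ?thesis using fin[of "U \<inter> Z"] by simp
  next
    case False
    have "of_nat n \<le> ?L" for n
      using infinite_arbitrarily_large[OF False, of n] fin by blast
    then have "?L = \<top>"
      using ennreal_Ex_less_of_nat[of ?L] by (metis leD top.not_eq_extremum)
    then show ?thesis by simp
  qed
qed

text \<open>The majorant is the lower limit of the number of cells containing a zero, as the mesh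
  tends to 0. Fatou's lemma bounds its integral, because for each mesh the bounds for the cells add
  up to the one for \<open>U\<close> by countable additivity of volume.\<close>

lemma zeros_majorant:
  fixes U :: "(real^'m) set"
  assumes J: "finite J" "p \<notin> J" and \<beta>: "\<And>a. a \<in> insert p J \<Longrightarrow> \<beta> a > 0" and U: "open U"
    and B: "\<And>x. x \<in> U \<Longrightarrow> pivot_bound \<beta> p J x \<le> B" "0 \<le> B"
  obtains F where "F \<in> borel_measurable (\<Pi>\<^sub>M a\<in>insert p J. borel)"
    "\<forall>v. emeasure (count_space UNIV) (U \<inter> zero_set (insert p J) \<beta> v) \<le> F v"
    "(\<integral>\<^sup>+v. F v \<partial>(\<Pi>\<^sub>M a\<in>insert p J. gauss)) \<le> coeff_moment J * ennreal B * emeasure lborel U"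
proof -
  have "\<exists>Q :: nat \<Rightarrow> (real^'m) set. disjoint_family Q \<and> (\<Union>j. Q j) = U \<and> (\<forall>j. fsigma (Q j) \<and> bounded (Q j))
      \<and> (\<forall>j x y. x \<in> Q j \<longrightarrow> y \<in> Q j \<longrightarrow> dist x y < inverse (real (Suc n)))" for n
  proof -
    have "inverse (real (Suc n)) > 0" by simp
    from small_fsigma_partition[OF U this] show ?thesis by metis
  qed
  then obtain Q :: "nat \<Rightarrow> nat \<Rightarrow> (real^'m) set" where Q: "\<And>n. disjoint_family (Q n)" "\<And>n. (\<Union>j. Q n j) = U"
      "\<And>n j. fsigma (Q n j)" "\<And>n j. bounded (Q n j)"
      "\<And>n j x y. x \<in> Q n j \<Longrightarrow> y \<in> Q n j \<Longrightarrow> dist x y < inverse (real (Suc n))"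
    by metis
  define h :: "nat \<Rightarrow> nat \<Rightarrow> _ \<Rightarrow> ennreal"
    where "h n j v = of_bool (Q n j \<inter> zero_set (insert p J) \<beta> v \<noteq> {})" for n j v
  have h[measurable]: "h n j \<in> borel_measurable (\<Pi>\<^sub>M a\<in>insert p J. borel)" for n j
    using pred_zero_in_fsigma[OF Q(3)[of n j], of "insert p J" \<beta>] unfolding h_def of_bool_def by measurable
  have h'[measurable]: "h n j \<in> borel_measurable (\<Pi>\<^sub>M a\<in>insert p J. gauss)" for n j
    using h by (simp only: measurable_cong_sets[OF sets_PiM_gauss refl])
  show thesis
  proof
    show "(\<lambda>v. liminf (\<lambda>n. \<Sum>j. h n j v)) \<in> borel_measurable (\<Pi>\<^sub>M a\<in>insert p J. borel)"
      by measurable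
    show "\<forall>v. emeasure (count_space UNIV) (U \<inter> zero_set (insert p J) \<beta> v) \<le> liminf (\<lambda>n. \<Sum>j. h n j v)"
      unfolding h_def by (intro allI count_le_liminf_partition[OF Q(1,2,5)])
    have "(\<integral>\<^sup>+v. (\<Sum>j. h n j v) \<partial>(\<Pi>\<^sub>M a\<in>insert p J. gauss)) \<le> coeff_moment J * ennreal B * emeasure lborel U" for n
    proof -
      have "(\<integral>\<^sup>+v. (\<Sum>j. h n j v) \<partial>(\<Pi>\<^sub>M a\<in>insert p J. gauss)) = (\<Sum>j. \<integral>\<^sup>+v. h n j v \<partial>(\<Pi>\<^sub>M a\<in>insert p J. gauss))"
        by (rule nn_integral_suminf) measurable
      also have "\<dots> \<le> (\<Sum>j. coeff_moment J * ennreal B * emeasure lborel (Q n j))"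
        unfolding h_def
        by (intro suminf_le summableI nn_integral_zero_exists_le[OF J \<beta> Q(3,4)] B) (use Q(2)[of n] in auto)
      also have "\<dots> = coeff_moment J * ennreal B * (\<Sum>j. emeasure lborel (Q n j))"
        by (rule ennreal_suminf_cmult)
      also have "(\<Sum>j. emeasure lborel (Q n j)) = emeasure lborel (\<Union>j. Q n j)"
        using borel_image_fsigma(1)[OF Q(3)] by (intro suminf_emeasure Q) auto
      finally show ?thesis by (simp only: Q(2))
    qed
    then have "liminf (\<lambda>n. \<integral>\<^sup>+v. (\<Sum>j. h n j v) \<partial>(\<Pi>\<^sub>M a\<in>insert p J. gauss))
        \<le> liminf (\<lambda>n. coeff_moment J * ennreal B * emeasure lborel U)"
      by (intro Liminf_mono always_eventually) auto
    then show "(\<integral>\<^sup>+v. liminf (\<lambda>n. \<Sum>j. h n j v) \<partial>(\<Pi>\<^sub>M a\<in>insert p J. gauss)) \<le> coeff_moment J * ennreal B * emeasure lborel U"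
      by (intro order_trans[OF nn_integral_liminf]) (auto simp: Liminf_const)
  qed
qed

text \<open>The normal density decreases in the modulus of its argument, so on \<open>S\<close> each
  factor is at least its value at \<open>R\<close>.\<close>

lemma emeasure_gauss_ge:
  fixes S :: "(real^'m) set"
  assumes [measurable]: "S \<in> sets borel" and S: "\<And>x i. x \<in> S \<Longrightarrow> \<bar>x $ i\<bar> \<le> R"
  shows "ennreal (std_normal_density R ^ CARD('m)) * emeasure lborel S \<le> emeasure gauss S"
proof -
  have le: "std_normal_density R \<le> std_normal_density t" if "\<bar>t\<bar> \<le> R" for t
  proof -
    have "t\<^sup>2 \<le> R\<^sup>2" using that by (metis abs_ge_zero abs_of_nonneg order_trans power2_abs power_mono)
    then show ?thesis by (simp add: std_normal_density_def divide_right_mono)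
  qed
  have "ennreal (std_normal_density R ^ CARD('m)) * emeasure lborel S
      = (\<integral>\<^sup>+x. ennreal (std_normal_density R ^ CARD('m)) * indicator S x \<partial>lborel)"
    by (simp add: nn_integral_cmult_indicator)
  also have "\<dots> \<le> (\<integral>\<^sup>+x. ennreal (\<Prod>i\<in>UNIV. std_normal_density (x $ i)) * indicator S x \<partial>lborel)"
  proof (rule nn_integral_mono)
    fix x :: "real^'m"
    have "(\<Prod>i\<in>(UNIV :: 'm set). std_normal_density R) \<le> (\<Prod>i\<in>UNIV. std_normal_density (x $ i))" if "x \<in> S"
      by (rule prod_mono) (use S[OF that] le in auto)
    then show "ennreal (std_normal_density R ^ CARD('m)) * indicator S x
        \<le> ennreal (\<Prod>i\<in>UNIV. std_normal_density (x $ i)) * indicator S x"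
      by (auto simp: indicator_def intro!: ennreal_leI)
  qed
  also have "\<dots> = emeasure gauss S"
    unfolding gauss_def by (rule emeasure_density[symmetric]) auto
  finally show ?thesis .
qed

lemma emeasure_std_normal_Icc_pos:
  assumes "a < b"
  shows "emeasure std_normal {a..b} > 0"
proof -
  have "emeasure std_normal {a..b} \<noteq> 0"
  proof
    assume "emeasure std_normal {a..b} = 0"
    then have "(\<integral>\<^sup>+t. ennreal (std_normal_density t) * indicator {a..b} t \<partial>lborel) = 0"
      by (simp add: emeasure_density)
    then have "AE t in lborel. ennreal (std_normal_density t) * indicator {a..b} t = 0"
      by (subst (asm) nn_integral_0_iff_AE) auto
    then have "AE t in lborel. t \<notin> {a..b}"
    proof eventually_elim
      case (elim t)
      moreover have "std_normal_density t > 0" by (simp add: normal_density_pos)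
      ultimately show ?case by (auto simp: indicator_def split: if_splits)
    qed
    then have "emeasure lborel {a..b} = 0"
      by (subst (asm) AE_iff_measurable[of "{a..b}"]) auto
    then show False using assms by simp
  qed
  then show ?thesis by (simp add: zero_less_iff_neq_zero)
qed

lemma emeasure_PiM_gauss_box:
  fixes E :: "real^'m \<Rightarrow> 'm \<Rightarrow> real set"
  assumes J: "finite J" and E[measurable]: "\<And>a i. E a i \<in> sets borel"
  defines "W \<equiv> {w \<in> space (\<Pi>\<^sub>M a\<in>J. (gauss :: (real^'m) measure)). \<forall>a\<in>J. \<forall>i. w a $ i \<in> E a i}"
  shows "W \<in> sets (\<Pi>\<^sub>M a\<in>J. gauss)"
    and "emeasure (\<Pi>\<^sub>M a\<in>J. gauss) W = (\<Prod>a\<in>J. \<Prod>i\<in>UNIV. emeasure std_normal (E a i))"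
proof -
  have W: "W = Pi\<^sub>E J (\<lambda>a. {x. \<forall>i. x $ i \<in> E a i})"
    by (auto simp: W_def space_PiM PiE_iff extensional_def)
  have m: "{x :: real^'m. \<forall>i. x $ i \<in> E a i} \<in> sets gauss" for a
    unfolding sets_gauss by measurable
  show "W \<in> sets (\<Pi>\<^sub>M a\<in>J. gauss)"
    unfolding W by (rule sets_PiM_I_finite[OF J m])
  have "emeasure (\<Pi>\<^sub>M a\<in>J. gauss) W = (\<Prod>a\<in>J. emeasure gauss {x :: real^'m. \<forall>i. x $ i \<in> E a i})"
    unfolding W by (rule gauss_PiM.emeasure_PiM[OF J m])
  then show "emeasure (\<Pi>\<^sub>M a\<in>J. gauss) W = (\<Prod>a\<in>J. \<Prod>i\<in>UNIV. emeasure std_normal (E a i))"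
    by (simp add: emeasure_gauss_box)
qed

section \<open>Finding zeros from below\<close>

lemma compact_imp_fsigma:
  fixes C :: "(real^'m) set"
  assumes "compact C"
  shows "fsigma C"
  unfolding fsigma_Union_compact by (rule exI[of _ "\<lambda>_. C"]) (use assms in auto)

lemma pivot_map_component_le:
  assumes "\<And>a. a \<in> J \<Longrightarrow> 0 \<le> pivot_coeff \<beta> p x a \<and> pivot_coeff \<beta> p x a \<le> 2" "\<And>a. a \<in> J \<Longrightarrow> \<bar>w a $ i\<bar> \<le> 2"
  shows "\<bar>pivot_map \<beta> p J w x $ i\<bar> \<le> 4 * real (card J)"
proof -
  have "\<bar>pivot_map \<beta> p J w x $ i\<bar> \<le> (\<Sum>a\<in>J. \<bar>pivot_coeff \<beta> p x a * w a $ i\<bar>)"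
    unfolding pivot_map_def sum_component vector_scaleR_component real_scaleR_def by (rule sum_abs)
  also have "\<dots> \<le> (\<Sum>a\<in>J. 2 * 2)"
    unfolding abs_mult by (intro sum_mono mult_mono) (use assms in auto)
  finally show ?thesis by simp
qed

text \<open>The order of quantifiers matters: \<open>c\<close> serves all \<beta>, \<open>p\<close>,
  \<open>x0\<close> and \<open>g\<close>, so it can be fixed before the point on the ray is chosen.
  Only the radius from which on the bound holds depends on these data. The radii form a sequence so
  that Fatou's lemma applies.\<close>

definition ball_zero_bound :: "(real^'m) set \<Rightarrow> real \<Rightarrow> bool" where
  "ball_zero_bound J c \<longleftrightarrow> (\<forall>\<beta> p x0 g. p \<notin> J \<longrightarrow> (\<forall>a\<in>insert p J. \<beta> a > 0) \<longrightarrow>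
     (\<forall>a\<in>J. pivot_coeff \<beta> p x0 a \<le> 1) \<longrightarrow> (\<forall>i. g i \<in> J) \<longrightarrow>
     (\<forall>f. (\<forall>i. f i \<in> J) \<longrightarrow> pivot_weight \<beta> p x0 f \<le> pivot_weight \<beta> p x0 g) \<longrightarrow>
     0 < pivot_weight \<beta> p x0 g \<longrightarrow>
     (\<forall>\<^sub>F n in sequentially. ennreal (c * pivot_weight \<beta> p x0 g) * emeasure lborel (cball x0 (inverse (real (Suc n))))
       \<le> (\<integral>\<^sup>+v. of_bool (cball x0 (inverse (real (Suc n))) \<inter> zero_set (insert p J) \<beta> v \<noteq> {}) \<partial>(\<Pi>\<^sub>M a\<in>insert p J. gauss))))"

text \<open>Restrict the coefficients to the event \<open>W\<close> on which the term of
  \<open>g\<close> dominates the Jacobian. Its probability is bounded below uniformly in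
  \<open>g\<close>, and on it the image of a small ball has volume comparable to the weight of
  \<open>g\<close> and stays in a fixed bounded region, where the Gaussian density is bounded
  below.\<close>

lemma ex_ball_zero_bound:
  fixes J :: "(real^'m) set"
  assumes J: "finite J"
  shows "\<exists>c>0. ball_zero_bound J c"
proof -
  let ?N = "real (card {f :: 'm \<Rightarrow> real^'m. \<forall>i. f i \<in> J})"
  \<comment> \<open>Small enough for \<open>abs_det_pivot_deriv_ge\<close>; the \<open>+ 1\<close>
    keeps it positive even if there are no choices at all, and the cap at 2 makes 2 a bound for
    every entry.\<close>
  define \<eta> where "\<eta> = min 2 (1 / (2 * (?N + 1) * 2 ^ CARD('m)))"
  have \<eta>: "\<eta> > 0" "\<eta> \<le> 2" "?N * (\<eta> * 2 ^ CARD('m)) \<le> 1 / 2"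
  proof -
    show "\<eta> > 0" unfolding \<eta>_def by (simp add: add_nonneg_pos)
    show "\<eta> \<le> 2" unfolding \<eta>_def by simp
    have "?N * (\<eta> * 2 ^ CARD('m)) \<le> ?N * (1 / (2 * (?N + 1) * 2 ^ CARD('m)) * 2 ^ CARD('m))"
      unfolding \<eta>_def by (intro mult_left_mono mult_right_mono) auto
    also have "\<dots> = ?N / (2 * (?N + 1))" by simp
    also have "\<dots> \<le> 1 / 2" by (simp add: field_simps)
    finally show "?N * (\<eta> * 2 ^ CARD('m)) \<le> 1 / 2" .
  qed
  define q where "q = min (emeasure std_normal {-2..-1}) (emeasure std_normal {-\<eta>..\<eta>})"
  have q0: "q > 0"
    unfolding q_def using emeasure_std_normal_Icc_pos \<eta>(1) by auto
  \<comment> \<open>A lower bound for the probability of \<open>W\<close>, whichever entries the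
    choice \<open>g\<close> singles out.\<close>
  define K where "K = (\<Prod>a\<in>J. \<Prod>i\<in>(UNIV :: 'm set). q)"
  have K0: "K > 0" unfolding K_def zero_less_iff_neq_zero using q0 J by auto
  have Kfin: "K < \<top>"
  proof -
    interpret N: prob_space std_normal by (rule prob_space_std_normal)
    have "q \<le> emeasure std_normal {-2..-1}" unfolding q_def by simp
    then have "q < \<top>"
      using N.emeasure_finite[of "{-2..-1}"] by (metis le_less_trans top.not_eq_extremum)
    then show ?thesis
      unfolding K_def by (simp add: power_less_top_ennreal)
  qed
  \<comment> \<open>The density at the edge of the region that contains the image: at most
    \<open>card J\<close> summands, each with ratio and entry at most 2.\<close>
  define \<gamma> where "\<gamma> = std_normal_density (4 * real (card J)) ^ CARD('m)"
  have \<gamma>0: "\<gamma> > 0" unfolding \<gamma>_def by (simp add: normal_density_pos)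
  \<comment> \<open>The limit argument yields the constant with 4 in place of 8; the slack makes the
    comparison strict, so that it holds for all late indices.\<close>
  define c where "c = enn2real K * \<gamma> / 8"
  have K: "ennreal (enn2real K) = K" "enn2real K > 0"
    using K0 Kfin by (auto simp: enn2real_positive_iff)
  have c0: "c > 0" unfolding c_def using K \<gamma>0 by simp
  have "ball_zero_bound J c"
    unfolding ball_zero_bound_def
  proof (intro allI impI)
    fix \<beta> :: "real^'m \<Rightarrow> real" and p x0 :: "real^'m" and g :: "'m \<Rightarrow> real^'m"
    assume p: "p \<notin> J" and \<beta>': "\<forall>a\<in>insert p J. \<beta> a > 0"
      and le1': "\<forall>a\<in>J. pivot_coeff \<beta> p x0 a \<le> 1" and g': "\<forall>i. g i \<in> J"
      and gmax': "\<forall>f. (\<forall>i. f i \<in> J) \<longrightarrow> pivot_weight \<beta> p x0 f \<le> pivot_weight \<beta> p x0 g"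
      and D0: "0 < pivot_weight \<beta> p x0 g"
    note \<beta> = \<beta>'[rule_format] and le1 = le1'[rule_format] and g = g'[rule_format] and gmax = gmax'[rule_format]
    define D where "D = pivot_weight \<beta> p x0 g"
    define r where "r n = inverse (real (Suc n))" for n
    define B where "B n = cball x0 (r n)" for n
    define L where "L n = measure lborel (B n)" for n
    define h where "h w = pivot_map \<beta> p J (\<lambda>a. - w a)" for w
    define u where "u n w = emeasure gauss (h w ` B n)" for n w
    \<comment> \<open>Only moduli matter: the entries selected by \<open>g\<close> have modulus in
      [1, 2], all others at most \<eta>.\<close>
    define E where "E a i = (if a = g i then {-2..-1} else {-\<eta>..\<eta>})" for a i
    define W where "W = {w \<in> space (\<Pi>\<^sub>M a\<in>J. (gauss :: (real^'m) measure)). \<forall>a\<in>J. \<forall>i. w a $ i \<in> E a i}"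
    have r0: "r n > 0" for n by (simp add: r_def)
    have rlim: "filterlim r (at_right 0) sequentially"
      unfolding filterlim_at using r0 LIMSEQ_inverse_real_of_nat by (auto simp: r_def[abs_def])
    have L0: "L n > 0" for n
      unfolding L_def B_def using content_cball_pos[OF r0] by simp
    have L: "emeasure lborel (B n) = ennreal (L n)" for n
      unfolding L_def B_def
      using emeasure_lborel_cball_finite[of x0 "r n"] by (intro emeasure_eq_ennreal_measure) auto
    have fs: "fsigma (B n)" for n
      unfolding B_def by (intro compact_imp_fsigma) auto
    have umeas[measurable]: "u n \<in> borel_measurable (\<Pi>\<^sub>M a\<in>J. gauss)" for n
      unfolding u_def[abs_def] h_def using \<beta> by (intro measurable_gauss_image[OF J p _ fs]) auto
    have P: "(\<integral>\<^sup>+v. of_bool (B n \<inter> zero_set (insert p J) \<beta> v \<noteq> {}) \<partial>(\<Pi>\<^sub>M a\<in>insert p J. gauss))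
        = (\<integral>\<^sup>+w. u n w \<partial>(\<Pi>\<^sub>M a\<in>J. gauss))" for n
      unfolding u_def h_def using \<beta> by (intro nn_integral_zero_exists[OF J p _ fs]) auto
    have E: "E a i \<in> sets borel" for a i by (simp add: E_def)
    have Wm: "W \<in> sets (\<Pi>\<^sub>M a\<in>J. gauss)" "emeasure (\<Pi>\<^sub>M a\<in>J. gauss) W \<ge> K"
    proof -
      show "W \<in> sets (\<Pi>\<^sub>M a\<in>J. gauss)"
        unfolding W_def by (rule emeasure_PiM_gauss_box[OF J E])
      have "emeasure (\<Pi>\<^sub>M a\<in>J. gauss) W = (\<Prod>a\<in>J. \<Prod>i\<in>UNIV. emeasure std_normal (E a i))"
        unfolding W_def by (rule emeasure_PiM_gauss_box[OF J E])
      also have "\<dots> \<ge> K"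
        unfolding K_def by (intro prod_mono_ennreal) (auto simp: q_def E_def)
      finally show "emeasure (\<Pi>\<^sub>M a\<in>J. gauss) W \<ge> K" .
    qed
    have coeff2: "\<forall>\<^sub>F n in sequentially. \<forall>x\<in>B n. \<forall>a\<in>J. pivot_coeff \<beta> p x a \<le> 2"
    proof -
      have "\<forall>\<^sub>F x in at x0. pivot_coeff \<beta> p x a < 2" if "a \<in> J" for a
      proof -
        have "isCont (\<lambda>x. pivot_coeff \<beta> p x a) x0"
          using continuous_on_pivot_coeff[of UNIV \<beta> p a]
          unfolding continuous_on_eq_continuous_at[OF open_UNIV] by blast
        then show ?thesis
          using le1[OF that] unfolding isCont_def by (intro order_tendstoD(2)) auto
      qed
      then have "\<forall>\<^sub>F x in at x0. \<forall>a\<in>J. pivot_coeff \<beta> p x a < 2"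
        using J by (simp add: eventually_ball_finite)
      then obtain e where e: "e > 0" "\<And>x. x \<noteq> x0 \<Longrightarrow> dist x x0 < e \<Longrightarrow> \<forall>a\<in>J. pivot_coeff \<beta> p x a < 2"
        by (auto simp: eventually_at)
      have "\<forall>\<^sub>F n in sequentially. r n < e"
        unfolding r_def using LIMSEQ_inverse_real_of_nat e(1) by (rule order_tendstoD)
      then show ?thesis
      proof eventually_elim
        case (elim n)
        show ?case
        proof (intro ballI)
          fix x a assume xa: "x \<in> B n" "a \<in> J"
          show "pivot_coeff \<beta> p x a \<le> 2"
          proof (cases "x = x0")
            case True
            then show ?thesis using le1[OF xa(2)] by simp
          next
            case False
            have "dist x x0 < e" using xa(1) elim by (simp add: B_def dist_commute)
            then show ?thesis using e(2)[OF False] xa(2) by (simp add: less_imp_le)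
          qed
        qed
      qed
    qed
    have low: "\<forall>\<^sub>F n in sequentially. ennreal (\<gamma> * D / 4) \<le> ennreal (1 / L n) * u n w" if w: "w \<in> W" for w
    proof -
      have wE: "w a $ i \<in> E a i" if "a \<in> J" for a i
        using w that by (simp add: W_def)
      have w2: "\<bar>(- w a) $ i\<bar> \<le> 2" if "a \<in> J" for a i
        using wE[OF that, of i] \<eta>(1,2) by (cases "a = g i") (auto simp: E_def)
      have "D / 2 \<le> \<bar>det (matrix (pivot_deriv \<beta> p J (\<lambda>a. - w a) x0))\<bar>"
        unfolding D_def
      proof (rule abs_det_pivot_deriv_ge[OF J _ _ g gmax _ w2 _ \<eta>(3)])
        show "1 \<le> \<bar>(- w (g i)) $ i\<bar>" for i
          using wE[OF g, of i i] by (auto simp: E_def)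
        show "\<bar>(- w a) $ i\<bar> \<le> \<eta>" if "a \<in> J" "a \<noteq> g i" for a i
          using wE[OF that(1), of i] that(2) by (auto simp: E_def)
      qed (use \<beta> \<eta> in auto)
      then have "\<forall>\<^sub>F s in at_right 0. ennreal (D / 2 / 2) * emeasure lborel (cball x0 s) \<le> emeasure lborel (h w ` cball x0 s)"
        unfolding h_def using D0 by (intro image_cball_measure_ge) (auto simp: D_def)
      then have "\<forall>\<^sub>F n in sequentially. ennreal (D / 2 / 2) * emeasure lborel (B n) \<le> emeasure lborel (h w ` B n)"
        unfolding B_def using rlim by (rule eventually_compose_filterlim)
      with coeff2 show ?thesis
      proof eventually_elim
        case (elim n)
        have "ennreal \<gamma> * emeasure lborel (h w ` B n) \<le> u n w"
          unfolding u_def \<gamma>_def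
        proof (rule emeasure_gauss_ge)
          show "h w ` B n \<in> sets borel"
            unfolding h_def by (rule borel_image_fsigma[OF fs])
          fix y i assume "y \<in> h w ` B n"
          then obtain x where x: "x \<in> B n" "y = h w x" by auto
          show "\<bar>y $ i\<bar> \<le> 4 * real (card J)"
            unfolding x(2) h_def
            by (rule pivot_map_component_le) (use elim(1) x(1) w2 \<beta> in \<open>auto intro: less_imp_le[OF pivot_coeff_pos]\<close>)
        qed
        then have "ennreal \<gamma> * (ennreal (D / 4) * ennreal (L n)) \<le> u n w"
          using elim(2) by (auto simp: L intro: order_trans[OF mult_left_mono])
        then have "ennreal (1 / L n) * (ennreal \<gamma> * (ennreal (D / 4) * ennreal (L n))) \<le> ennreal (1 / L n) * u n w"
          by (rule mult_left_mono) simp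
        also have "ennreal (1 / L n) * (ennreal \<gamma> * (ennreal (D / 4) * ennreal (L n))) = ennreal (\<gamma> * D / 4)"
          using L0[of n] \<gamma>0 D0 by (simp add: ennreal_mult[symmetric] D_def)
        finally show ?case .
      qed
    qed
    \<comment> \<open>Fatou's lemma turns the pointwise bound, whose threshold depends on
      \<open>w\<close>, into a bound on the average over \<open>w\<close> that holds for all late
      \<open>n\<close>.\<close>
    have "K * ennreal (\<gamma> * D / 4) \<le> emeasure (\<Pi>\<^sub>M a\<in>J. gauss) W * ennreal (\<gamma> * D / 4)"
      by (intro mult_right_mono Wm) simp
    also have "\<dots> = (\<integral>\<^sup>+w. ennreal (\<gamma> * D / 4) * indicator W w \<partial>(\<Pi>\<^sub>M a\<in>J. gauss))"
      unfolding nn_integral_cmult_indicator[OF Wm(1)] by (rule mult.commute)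
    also have "\<dots> \<le> (\<integral>\<^sup>+w. liminf (\<lambda>n. ennreal (1 / L n) * u n w) \<partial>(\<Pi>\<^sub>M a\<in>J. gauss))"
      by (intro nn_integral_mono) (auto simp: indicator_def intro: Liminf_bounded[OF low])
    also have "\<dots> \<le> liminf (\<lambda>n. \<integral>\<^sup>+w. ennreal (1 / L n) * u n w \<partial>(\<Pi>\<^sub>M a\<in>J. gauss))"
      by (rule nn_integral_liminf) measurable
    finally have "K * ennreal (\<gamma> * D / 4) \<le> liminf (\<lambda>n. ennreal (1 / L n) * (\<integral>\<^sup>+w. u n w \<partial>(\<Pi>\<^sub>M a\<in>J. gauss)))"
      by (simp add: nn_integral_cmult)
    moreover have "ennreal (c * D) < K * ennreal (\<gamma> * D / 4)"
    proof -
      have "K * ennreal (\<gamma> * D / 4) = ennreal (enn2real K * (\<gamma> * D / 4))"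
        by (subst ennreal_mult) (use K \<gamma>0 D0 in \<open>simp_all add: D_def\<close>)
      moreover have "c * D < enn2real K * (\<gamma> * D / 4)"
        using K(2) \<gamma>0 D0 by (simp add: c_def D_def)
      ultimately show ?thesis
        using c0 D0 by (simp add: ennreal_less_iff D_def)
    qed
    ultimately have "\<forall>\<^sub>F n in sequentially. ennreal (c * D) < ennreal (1 / L n) * (\<integral>\<^sup>+w. u n w \<partial>(\<Pi>\<^sub>M a\<in>J. gauss))"
      by (intro less_LiminfD) (rule less_le_trans)
    then show "\<forall>\<^sub>F n in sequentially. ennreal (c * pivot_weight \<beta> p x0 g) * emeasure lborel (cball x0 (inverse (real (Suc n))))
         \<le> (\<integral>\<^sup>+v. of_bool (cball x0 (inverse (real (Suc n))) \<inter> zero_set (insert p J) \<beta> v \<noteq> {}) \<partial>(\<Pi>\<^sub>M a\<in>insert p J. gauss))"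
    proof eventually_elim
      case (elim n)
      have "ennreal (c * D) * ennreal (L n) \<le> ennreal (1 / L n) * (\<integral>\<^sup>+w. u n w \<partial>(\<Pi>\<^sub>M a\<in>J. gauss)) * ennreal (L n)"
        using elim by (intro mult_right_mono) auto
      also have "\<dots> = (\<integral>\<^sup>+w. u n w \<partial>(\<Pi>\<^sub>M a\<in>J. gauss)) * (ennreal (1 / L n) * ennreal (L n))"
        by (simp only: mult_ac)
      also have "ennreal (1 / L n) * ennreal (L n) = 1"
        using L0[of n] by (simp add: ennreal_mult[symmetric])
      finally have "ennreal (c * D) * emeasure lborel (B n) \<le> (\<integral>\<^sup>+w. u n w \<partial>(\<Pi>\<^sub>M a\<in>J. gauss))"
        by (simp only: L mult_1_right)
      then show ?case
        unfolding P[symmetric] unfolding D_def B_def r_def .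
    qed
  qed
  then show ?thesis using c0 by blast
qed

section \<open>Comparing the two bounds along a ray\<close>

lemma span_rows_iff_det:
  fixes f :: "'m::finite \<Rightarrow> real^'m"
  shows "det (\<chi> i. f i) \<noteq> 0 \<longleftrightarrow> span (range f) = UNIV"
proof -
  have rows: "rows (\<chi> i. f i) = range f"
    by (auto simp: rows_def row_def)
  have "det (\<chi> i. f i) \<noteq> 0 \<longleftrightarrow> dim (range f) = DIM(real^'m)"
    using rank_bound[of "\<chi> i. f i"] by (auto simp: det_eq_0_rank row_rank_def rows)
  then show ?thesis
    by (simp only: dim_eq_full)
qed

lemma basis_enumeration:
  fixes B :: "(real^'m) set"
  assumes "independent B" "span B = UNIV"
  obtains h where "bij_betw h (UNIV :: 'm set) B"
proof -
  have "card B = CARD('m)"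
    using assms by (metis dim_UNIV dim_eq_card_independent dim_span DIM_cart DIM_real mult_1_right)
  then show thesis
    using finite_same_card_bij[of "UNIV :: 'm set" B] independent_imp_finite[OF assms(1)] that by auto
qed

text \<open>Take a maximal independent set \<open>I\<close> among the vectors
  \<open>f i - a1\<close>. Together with \<open>a0 - a1\<close> it spans everything, so it lacks at
  most one vector for a basis. The missing vector, taken from the differences of \<open>A\<close>,
  costs at most a factor \<delta>; the factors of \<open>f\<close> that are dropped are at most
  1.\<close>

lemma exchange_rows:
  fixes A :: "(real^'m) set" and \<psi> :: "real^'m \<Rightarrow> real"
  assumes A: "span ((\<lambda>a. a - a1) ` A) = UNIV"
    and f: "\<And>i. f i \<in> A" "det (\<chi> i. f i - a0) \<noteq> 0"
    and \<psi>: "\<And>a. a \<in> A \<Longrightarrow> \<delta> \<le> \<psi> a" "\<And>a. a \<in> A \<Longrightarrow> \<psi> a \<le> 1" and \<delta>: "0 < \<delta>" "\<delta> \<le> 1"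
  obtains g where "\<forall>i. g i \<in> A" "det (\<chi> i. g i - a1) \<noteq> 0"
    "\<delta> * (\<Prod>i\<in>UNIV. \<psi> (f i)) \<le> (\<Prod>i\<in>UNIV. \<psi> (g i))"
proof -
  let ?V = "(\<lambda>a. a - a1) ` A" and ?W = "range (\<lambda>i. f i - a1)"
  have \<psi>0: "0 \<le> \<psi> a" if "a \<in> A" for a using \<psi>(1)[OF that] \<delta> by linarith
  obtain I where I: "I \<subseteq> ?W" "independent I" "?W \<subseteq> span I"
    by (rule maximal_independent_subset)
  have "I \<subseteq> ?V" using I(1) f(1) by auto
  then obtain B where B: "I \<subseteq> B" "B \<subseteq> ?V" "independent B" "?V \<subseteq> span B"
    using I(2) by (rule maximal_independent_subset_extend)
  have spanB: "span B = UNIV"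
    using A B(4) by (metis span_mono span_span top.extremum_unique)
  obtain h where h: "bij_betw h (UNIV :: 'm set) B"
    using basis_enumeration[OF B(3) spanB] .
  have cardB: "card B = CARD('m)"
    using bij_betw_same_card[OF h] by simp
  have finB: "finite B" using B(3) by (rule independent_imp_finite)
  then have finI: "finite I" using B(1) finite_subset by blast
  have "span (insert (a0 - a1) I) = UNIV"
  proof -
    have "f i - a0 \<in> span (insert (a0 - a1) I)" for i
    proof -
      have "f i - a1 \<in> span (insert (a0 - a1) I)"
        using I(3) span_mono[of I "insert (a0 - a1) I"] by blast
      moreover have "a0 - a1 \<in> span (insert (a0 - a1) I)"
        by (rule span_base) simp
      ultimately have "(f i - a1) - (a0 - a1) \<in> span (insert (a0 - a1) I)"
        by (rule span_diff)
      then show ?thesis by simp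
    qed
    then have "range (\<lambda>i. f i - a0) \<subseteq> span (insert (a0 - a1) I)" by auto
    then have "span (range (\<lambda>i. f i - a0)) \<subseteq> span (insert (a0 - a1) I)"
      by (rule span_minimal) simp
    then show ?thesis
      using f(2) unfolding span_rows_iff_det by blast
  qed
  then have "CARD('m) \<le> card (insert (a0 - a1) I)"
    using finI by (metis dim_UNIV dim_le_card' dim_span DIM_cart DIM_real mult_1_right finite_insert)
  also have "\<dots> \<le> Suc (card I)" using finI by (simp add: card_insert_if)
  finally have "card (B - I) \<le> 1"
    using cardB card_Diff_subset[OF finI B(1)] by simp
  define g where "g i = h i + a1" for i
  have hV: "h i \<in> ?V" for i using h B(2) by (auto simp: bij_betw_def)
  have BA: "b + a1 \<in> A" if "b \<in> B" for b using that B(2) by auto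
  show thesis
  proof
    show "\<forall>i. g i \<in> A"
    proof
      fix i show "g i \<in> A" using hV[of i] by (auto simp: g_def)
    qed
    have "range (\<lambda>i. g i - a1) = B" using h by (simp add: g_def bij_betw_def)
    then show "det (\<chi> i. g i - a1) \<noteq> 0"
      unfolding span_rows_iff_det using spanB by simp
    have "(\<Prod>i\<in>UNIV. \<psi> (g i)) = (\<Prod>b\<in>B. \<psi> (b + a1))"
      unfolding g_def using prod.reindex_bij_betw[OF h, of "\<lambda>b. \<psi> (b + a1)"] .
    also have "\<dots> = (\<Prod>b\<in>B - I. \<psi> (b + a1)) * (\<Prod>b\<in>I. \<psi> (b + a1))"
      using finB B(1) by (rule prod.subset_diff[rotated])
    also have "\<dots> \<ge> \<delta> * (\<Prod>i\<in>UNIV. \<psi> (f i))"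
    proof (rule mult_mono)
      have "\<delta> ^ 1 \<le> \<delta> ^ card (B - I)"
        using \<open>card (B - I) \<le> 1\<close> \<delta> by (intro power_decreasing) auto
      also have "\<dots> = (\<Prod>b\<in>B - I. \<delta>)" by simp
      also have "\<dots> \<le> (\<Prod>b\<in>B - I. \<psi> (b + a1))"
        using \<delta> \<psi>(1) BA by (intro prod_mono) auto
      finally show "\<delta> \<le> (\<Prod>b\<in>B - I. \<psi> (b + a1))" by simp
      have "\<forall>b\<in>I. \<exists>i. b = f i - a1" using I(1) by auto
      \<comment> \<open>One row of \<open>f\<close> is chosen for each vector of \<open>I\<close>;
        the other rows are the ones dropped.\<close>
      then obtain s where s: "\<forall>b\<in>I. b = f (s b) - a1" by (rule bchoice[THEN exE])
      have inj: "inj_on s I"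
      proof (rule inj_onI)
        fix b c assume "b \<in> I" "c \<in> I" "s b = s c"
        then show "b = c" using s[rule_format, of b] s[rule_format, of c] by simp
      qed
      have "(\<Prod>i\<in>UNIV. \<psi> (f i)) = (\<Prod>i\<in>UNIV - s ` I. \<psi> (f i)) * (\<Prod>i\<in>s ` I. \<psi> (f i))"
        by (rule prod.subset_diff) auto
      also have "\<dots> \<le> 1 * (\<Prod>i\<in>s ` I. \<psi> (f i))"
        using \<psi>0 \<psi>(2) f(1) by (intro mult_right_mono prod_le_1 prod_nonneg) auto
      also have "\<dots> = (\<Prod>b\<in>I. \<psi> (f (s b)))"
        using inj by (simp add: prod.reindex)
      also have "\<dots> = (\<Prod>b\<in>I. \<psi> (b + a1))"
      proof (rule prod.cong[OF refl])
        fix b assume "b \<in> I"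
        then have "f (s b) = b + a1" using s[rule_format, of b] by (simp add: algebra_simps)
        then show "\<psi> (f (s b)) = \<psi> (b + a1)" by simp
      qed
      finally show "(\<Prod>i\<in>UNIV. \<psi> (f i)) \<le> (\<Prod>b\<in>I. \<psi> (b + a1))" .
      show "0 \<le> (\<Prod>b\<in>B - I. \<psi> (b + a1))" "0 \<le> (\<Prod>i\<in>UNIV. \<psi> (f i))"
        using \<psi>0 BA f(1) by (auto intro!: prod_nonneg)
    qed
    finally show "\<delta> * (\<Prod>i\<in>UNIV. \<psi> (f i)) \<le> (\<Prod>i\<in>UNIV. \<psi> (g i))" .
  qed
qed

lemma finite_bounds:
  fixes h :: "'a \<Rightarrow> real"
  assumes "finite S"
  obtains b where "b > 0" "\<forall>s\<in>S. h s > 0 \<longrightarrow> b \<le> h s"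
proof -
  \<comment> \<open>The 1 covers the case that no value is positive.\<close>
  let ?S = "insert 1 (h ` {s \<in> S. h s > 0})"
  have "finite ?S" using assms by auto
  then show thesis
    by (intro that[of "Min ?S"]) (auto simp: Min_gr_iff intro!: Min_le)
qed

text \<open>At each point of the ray the pivot \<open>a1\<close> is the largest term of the original
  sum. Rewriting the ratios relative to \<open>a0\<close> as ratios relative to \<open>a1\<close>
  gains \<open>exp (- T * d)\<close> in each row, and the exchange of one row loses at most
  \<open>exp (T * w)\<close>, up to constants. The constant \<open>C\<close> is chosen before
  \<open>T\<close>.\<close>

lemma pivot_bound_compare:
  fixes A :: "(real^'m) set" and u :: "real^'m"
  assumes A: "finite A" "A \<noteq> {}" "\<And>a1. a1 \<in> A \<Longrightarrow> span ((\<lambda>a. a - a1) ` A) = UNIV"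
    and \<alpha>: "\<And>a. a \<in> A \<Longrightarrow> \<alpha> a > 0" "\<alpha>0 > 0" and a0: "a0 \<notin> A"
    and u: "\<And>a. a \<in> A \<Longrightarrow> d \<le> (a0 - a) \<bullet> u" "\<And>a b. a \<in> A \<Longrightarrow> b \<in> A \<Longrightarrow> (a - b) \<bullet> u \<le> w"
  obtains C where "C > 0" "\<forall>T\<ge>0. \<exists>a1\<in>A. \<exists>g. (\<forall>a\<in>A - {a1}. pivot_coeff \<alpha> a1 (T *\<^sub>R u) a \<le> 1)
      \<and> (\<forall>i. g i \<in> A - {a1})
      \<and> (\<forall>f. (\<forall>i. f i \<in> A - {a1}) \<longrightarrow> pivot_weight \<alpha> a1 (T *\<^sub>R u) f \<le> pivot_weight \<alpha> a1 (T *\<^sub>R u) g)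
      \<and> 0 < pivot_weight \<alpha> a1 (T *\<^sub>R u) g
      \<and> pivot_bound (\<alpha>(a0 := \<alpha>0)) a0 A (T *\<^sub>R u)
          \<le> C * exp (- T * (real CARD('m) * d - w)) * pivot_weight \<alpha> a1 (T *\<^sub>R u) g"
proof -
  let ?m = "CARD('m)"
  let ?F = "{f :: 'm \<Rightarrow> real^'m. \<forall>i. f i \<in> A}"
  have finF: "finite ?F" by (rule finite_choices[OF A(1)])
  obtain \<rho>0 where \<rho>0: "\<rho>0 > 0" "\<forall>s\<in>A \<times> A. \<alpha> (fst s) / \<alpha> (snd s) > 0 \<longrightarrow> \<rho>0 \<le> \<alpha> (fst s) / \<alpha> (snd s)"
    using finite_bounds[of "A \<times> A" "\<lambda>s. \<alpha> (fst s) / \<alpha> (snd s)"] A(1) by auto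
  define \<rho> where "\<rho> = min 1 \<rho>0"
  have \<rho>: "\<rho> > 0" "\<rho> \<le> 1" "\<And>a b. a \<in> A \<Longrightarrow> b \<in> A \<Longrightarrow> \<rho> \<le> \<alpha> a / \<alpha> b"
    using \<rho>0 \<alpha>(1) by (auto simp: \<rho>_def min_le_iff_disj)
  obtain Dm where Dm: "Dm > 0" "\<forall>s\<in>A \<times> ?F. \<bar>det (\<chi> i. snd s i - fst s)\<bar> > 0 \<longrightarrow> Dm \<le> \<bar>det (\<chi> i. snd s i - fst s)\<bar>"
    using finite_bounds[of "A \<times> ?F" "\<lambda>s. \<bar>det (\<chi> i. snd s i - fst s)\<bar>"] A(1) finF by auto
  define Mx where "Mx = Max (\<alpha> ` A)"
  have Mx: "\<alpha> a \<le> Mx" if "a \<in> A" for a unfolding Mx_def using A(1) that by simp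
  have Mx0: "Mx > 0" using A(2) Mx \<alpha>(1) by (metis ex_in_conv less_le_trans)
  \<comment> \<open>Collects what does not depend on \<open>T\<close>: ratios of coefficients and
    determinants. The \<open>+ 1\<close> makes it positive.\<close>
  define C where "C = (\<Sum>f\<in>?F. (Mx / \<alpha>0) ^ ?m / (\<rho> * Dm) * \<bar>det (\<chi> i. f i - a0)\<bar>) + 1"
  have C: "C > 0"
    unfolding C_def using Mx0 \<alpha>(2) \<rho> Dm by (intro add_nonneg_pos sum_nonneg) auto
  show thesis
  proof (rule that[OF C], intro allI impI)
    fix T :: real assume T: "T \<ge> 0"
    let ?x = "T *\<^sub>R u"
    obtain a1 where a1: "a1 \<in> A" "\<And>a. a \<in> A \<Longrightarrow> \<alpha> a * exp (a \<bullet> ?x) \<le> \<alpha> a1 * exp (a1 \<bullet> ?x)"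
    proof -
      let ?v = "\<lambda>a. \<alpha> a * exp (a \<bullet> ?x)"
      have "Max (?v ` A) \<in> ?v ` A" using A by (intro Max_in) auto
      then obtain a where "a \<in> A" "Max (?v ` A) = ?v a" by auto
      moreover have "?v b \<le> Max (?v ` A)" if "b \<in> A" for b
        using A(1) that by (intro Max_ge) auto
      ultimately show thesis using that[of a] by simp
    qed
    define \<psi> where "\<psi> = pivot_coeff \<alpha> a1 ?x"
    define \<delta> where "\<delta> = \<rho> * exp (- T * w)"
    have w0: "0 \<le> w" using u(2)[OF a1(1) a1(1)] by simp
    have \<delta>: "0 < \<delta>" "\<delta> \<le> 1"
      using \<rho> T w0 by (auto simp: \<delta>_def intro!: mult_le_one)
    have \<psi>1: "\<psi> a \<le> 1" if "a \<in> A" for a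
      using a1(2)[OF that] \<alpha>(1)[OF a1(1)] unfolding \<psi>_def pivot_coeff_def
      by (simp add: inner_diff_left exp_diff field_simps)
    \<comment> \<open>No term is smaller than the dominant one by more than the factor \<delta>,
      since the width of \<open>A\<close> in direction \<open>u\<close> is at most
      \<open>w\<close>.\<close>
    have \<psi>\<delta>: "\<delta> \<le> \<psi> a" if "a \<in> A" for a
    proof -
      have "- T * w \<le> (a - a1) \<bullet> ?x"
        using mult_left_mono[OF u(2)[OF a1(1) that] T] by (simp add: inner_diff_left algebra_simps)
      then show ?thesis
        unfolding \<delta>_def \<psi>_def pivot_coeff_def using \<rho>(1) \<rho>(3)[OF that a1(1)]
        by (intro mult_mono) auto
    qed
    have \<psi>0: "0 < \<psi> a" if "a \<in> A" for a using \<psi>\<delta>[OF that] \<delta>(1) by linarith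
    let ?J = "A - {a1}"
    let ?G = "{f :: 'm \<Rightarrow> real^'m. \<forall>i. f i \<in> ?J}"
    let ?wt = "pivot_weight \<alpha> a1 ?x"
    have wt: "?wt f = (\<Prod>i\<in>UNIV. \<psi> (f i)) * \<bar>det (\<chi> i. f i - a1)\<bar>" for f
      by (simp add: pivot_weight_def \<psi>_def)
    have inG: "g \<in> ?G" if "\<And>i. g i \<in> A" "det (\<chi> i. g i - a1) \<noteq> 0" for g :: "'m \<Rightarrow> real^'m"
    proof -
      have "g i \<noteq> a1" for i
      proof
        assume "g i = a1"
        then have "row i (\<chi> i. g i - a1) = 0" by (simp add: row_def vec_eq_iff)
        then show False using that(2) det_zero_row(2) by blast
      qed
      then show ?thesis using that(1) by auto
    qed
    \<comment> \<open>The base point \<open>b\<close> is left free: \<open>b = a1\<close> shows that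
      some weight is positive, and \<open>b = a0\<close> gives the comparison with the enlarged
      system.\<close>
    have key: "\<exists>g\<in>?G. 0 < ?wt g \<and> \<rho> * Dm * exp (- T * w) * (\<Prod>i\<in>UNIV. \<psi> (f i)) \<le> ?wt g"
      if f: "\<And>i. f i \<in> A" "det (\<chi> i. f i - b) \<noteq> 0" for f b
    proof -
      obtain g where g: "\<forall>i. g i \<in> A" "det (\<chi> i. g i - a1) \<noteq> 0" "\<delta> * (\<Prod>i\<in>UNIV. \<psi> (f i)) \<le> (\<Prod>i\<in>UNIV. \<psi> (g i))"
        using exchange_rows[OF A(3)[OF a1(1)] f, of \<delta> \<psi>, OF \<psi>\<delta> \<psi>1 \<delta>] by blast
      have pos: "0 < (\<Prod>i\<in>UNIV. \<psi> (g i))" "0 < (\<Prod>i\<in>UNIV. \<psi> (f i))" using \<psi>0 g(1) f(1) by (auto intro: prod_pos)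
      have "Dm \<le> \<bar>det (\<chi> i. g i - a1)\<bar>"
        using Dm(2)[rule_format, of "(a1, g)"] a1(1) g by auto
      then have "\<delta> * (\<Prod>i\<in>UNIV. \<psi> (f i)) * Dm \<le> ?wt g"
        unfolding wt using g(3) pos Dm(1) \<delta> by (intro mult_mono) auto
      moreover have "0 < ?wt g" unfolding wt using pos g(2) by simp
      ultimately show ?thesis
        using inG[OF g(1)[rule_format] g(2)] by (intro bexI[of _ g]) (auto simp: \<delta>_def mult_ac)
    qed
    have fin: "finite ?G" by (rule finite_choices) (use A(1) in auto)
    obtain f1 :: "'m \<Rightarrow> real^'m" where f1: "\<And>i. f1 i \<in> A" "det (\<chi> i. f1 i - a1) \<noteq> 0"
    proof -
      obtain B where B: "B \<subseteq> (\<lambda>a. a - a1) ` A" "independent B" "(\<lambda>a. a - a1) ` A \<subseteq> span B"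
        by (rule maximal_independent_subset)
      have spanB: "span B = UNIV"
        using A(3)[OF a1(1)] B(3) by (metis span_mono span_span top.extremum_unique)
      obtain h where h: "bij_betw h (UNIV :: 'm set) B"
        using basis_enumeration[OF B(2) spanB] .
      show thesis
      proof (rule that[of "\<lambda>i. h i + a1"])
        show "h i + a1 \<in> A" for i
        proof -
          have "h i \<in> (\<lambda>a. a - a1) ` A" using h B(1) by (auto simp: bij_betw_def)
          then show ?thesis by auto
        qed
        have "range (\<lambda>i. h i + a1 - a1) = B" using h by (simp add: bij_betw_def)
        then show "det (\<chi> i. h i + a1 - a1) \<noteq> 0"
          unfolding span_rows_iff_det using spanB by simp
      qed
    qed
    obtain g1 where g1: "g1 \<in> ?G" "0 < ?wt g1" using key[OF f1] by blast
    have "Max (?wt ` ?G) \<in> ?wt ` ?G" using fin g1(1) by (intro Max_in) auto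
    then obtain g where g: "g \<in> ?G" "Max (?wt ` ?G) = ?wt g" by auto
    have gmax: "?wt f \<le> ?wt g" if "f \<in> ?G" for f
      unfolding g(2)[symmetric] using fin that by (intro Max_ge) auto
    have gpos: "0 < ?wt g" using gmax[OF g1(1)] g1(2) by linarith
    let ?\<beta> = "\<alpha>(a0 := \<alpha>0)" and ?e = "exp (- T * (real ?m * d - w))"
    have "pivot_weight ?\<beta> a0 ?x f \<le> (Mx / \<alpha>0) ^ ?m / (\<rho> * Dm) * \<bar>det (\<chi> i. f i - a0)\<bar> * (?e * ?wt g)"
      if f: "f \<in> ?F" for f
    proof (cases "det (\<chi> i. f i - a0) = 0")
      case True
      then show ?thesis by (simp add: pivot_weight_def)
    next
      case False
      have fA: "f i \<in> A" for i using f by simp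
      obtain g' where g': "g' \<in> ?G" "\<rho> * Dm * exp (- T * w) * (\<Prod>i\<in>UNIV. \<psi> (f i)) \<le> ?wt g'"
        using key[OF fA False] by blast
      have le: "\<rho> * Dm * exp (- T * w) * (\<Prod>i\<in>UNIV. \<psi> (f i)) \<le> ?wt g"
        using g'(2) gmax[OF g'(1)] by linarith
      \<comment> \<open>Split \<open>a - a0\<close> into \<open>a1 - a0\<close>, which contributes
        the gain, and \<open>a - a1\<close>, which is accounted for by \<psi>.\<close>
      have "pivot_coeff ?\<beta> a0 ?x a \<le> Mx / \<alpha>0 * exp (- T * d) * \<psi> a" if a: "a \<in> A" for a
      proof -
        have e: "exp ((a - a0) \<bullet> ?x) = exp ((a1 - a0) \<bullet> ?x) * exp ((a - a1) \<bullet> ?x)"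
          by (simp add: inner_diff_left algebra_simps flip: exp_add)
        have "pivot_coeff ?\<beta> a0 ?x a = \<alpha> a1 / \<alpha>0 * exp ((a1 - a0) \<bullet> ?x) * \<psi> a"
          unfolding pivot_coeff_def \<psi>_def e using a a0 \<alpha>(1)[OF a1(1)] by auto
        also have "\<dots> \<le> Mx / \<alpha>0 * exp (- T * d) * \<psi> a"
        proof (intro mult_right_mono mult_mono divide_right_mono)
          have "T * d \<le> T * ((a0 - a1) \<bullet> u)"
            using u(1)[OF a1(1)] T by (rule mult_left_mono)
          then show "exp ((a1 - a0) \<bullet> ?x) \<le> exp (- T * d)"
            by (simp add: inner_diff_left algebra_simps)
        qed (use Mx a1(1) \<alpha> Mx0 \<psi>0[OF a] in auto)
        finally show ?thesis .
      qed
      then have "(\<Prod>i\<in>UNIV. pivot_coeff ?\<beta> a0 ?x (f i)) \<le> (\<Prod>i\<in>UNIV. Mx / \<alpha>0 * exp (- T * d) * \<psi> (f i))"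
        using fA \<alpha> a0 by (intro prod_mono conjI less_imp_le[OF pivot_coeff_pos]) (auto split: if_splits)
      also have "\<dots> = (Mx / \<alpha>0) ^ ?m * exp (- T * d) ^ ?m * (\<Prod>i\<in>UNIV. \<psi> (f i))"
        by (simp only: prod.distrib prod_constant)
      also have "\<dots> \<le> (Mx / \<alpha>0) ^ ?m * exp (- T * d) ^ ?m * (?wt g / (\<rho> * Dm * exp (- T * w)))"
        using le \<rho> Dm Mx0 \<alpha>(2) by (intro mult_left_mono) (auto simp: pos_le_divide_eq mult_ac)
      also have "\<dots> = (Mx / \<alpha>0) ^ ?m / (\<rho> * Dm) * (?e * ?wt g)"
      proof -
        have "exp (- T * d) ^ ?m / exp (- T * w) = ?e"
          by (simp add: exp_of_nat_mult[symmetric] exp_diff[symmetric] algebra_simps)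
        then show ?thesis by (simp add: field_simps)
      qed
      finally have "(\<Prod>i\<in>UNIV. pivot_coeff ?\<beta> a0 ?x (f i)) * \<bar>det (\<chi> i. f i - a0)\<bar>
          \<le> (Mx / \<alpha>0) ^ ?m / (\<rho> * Dm) * (?e * ?wt g) * \<bar>det (\<chi> i. f i - a0)\<bar>"
        by (rule mult_right_mono) simp
      then show ?thesis by (simp only: pivot_weight_def mult_ac)
    qed
    then have "pivot_bound ?\<beta> a0 A ?x \<le> (\<Sum>f\<in>?F. (Mx / \<alpha>0) ^ ?m / (\<rho> * Dm) * \<bar>det (\<chi> i. f i - a0)\<bar> * (?e * ?wt g))"
      unfolding pivot_bound_def by (rule sum_mono)
    also have "\<dots> = (C - 1) * (?e * ?wt g)"
      by (simp add: C_def sum_distrib_right)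
    also have "\<dots> \<le> C * ?e * ?wt g"
      using gpos by (simp add: algebra_simps)
    finally have "pivot_bound ?\<beta> a0 A ?x \<le> C * ?e * ?wt g" .
    then show "\<exists>a1\<in>A. \<exists>g. (\<forall>a\<in>A - {a1}. pivot_coeff \<alpha> a1 ?x a \<le> 1)
      \<and> (\<forall>i. g i \<in> A - {a1})
      \<and> (\<forall>f. (\<forall>i. f i \<in> A - {a1}) \<longrightarrow> pivot_weight \<alpha> a1 ?x f \<le> pivot_weight \<alpha> a1 ?x g)
      \<and> 0 < pivot_weight \<alpha> a1 ?x g
      \<and> pivot_bound ?\<beta> a0 A ?x \<le> C * ?e * pivot_weight \<alpha> a1 ?x g"
      using a1(1) g(1) gmax gpos \<psi>1
      by (intro bexI[of _ a1] exI[of _ g]) (auto simp: \<psi>_def)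
  qed
qed

section \<open>The geometry of the convex hull\<close>

text \<open>Let \<open>u\<close> point from the closest point of the hull to \<open>a0\<close>. The
  variational inequality of the projection gives the lower bound on
  \<open>(a0 - a) \<bullet> u\<close>, and Cauchy-Schwarz bounds the width in direction
  \<open>u\<close> by the diameter.\<close>

lemma separating_direction:
  fixes A :: "(real^'m) set"
  assumes A: "finite A" "A \<noteq> {}" and d: "infdist a0 (convex hull A) > 0"
  obtains u where "norm u = 1" "\<forall>a\<in>A. infdist a0 (convex hull A) \<le> (a0 - a) \<bullet> u"
    "\<forall>a\<in>A. \<forall>b\<in>A. (a - b) \<bullet> u \<le> diameter (convex hull A)"
proof -
  let ?P = "convex hull A" and ?d = "infdist a0 (convex hull A)"
  have P: "compact ?P" "closed ?P" "convex ?P" "?P \<noteq> {}"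
    using A by (auto intro: finite_imp_compact_convex_hull compact_imp_closed)
  define p where "p = closest_point ?P a0"
  have p: "p \<in> ?P" "dist a0 p = ?d"
    unfolding p_def using P closest_point_in_set[OF P(2,4)] setdist_closest_point[OF P(2,4), of a0]
    by (auto simp: infdist_eq_setdist)
  define u where "u = (a0 - p) /\<^sub>R ?d"
  have u1: "norm u = 1" using p(2) d by (simp add: u_def dist_norm)
  show thesis
  proof (rule that[OF u1]; intro ballI)
    fix a assume a: "a \<in> A"
    then have aP: "a \<in> ?P" by (rule hull_inc)
    have "(a0 - p) \<bullet> (a - p) \<le> 0"
      unfolding p_def by (rule closest_point_dot[OF P(3,2) aP])
    moreover have "(a0 - p) \<bullet> (a0 - p) = ?d * ?d"
      using p(2) by (metis dist_norm power2_eq_square power2_norm_eq_inner)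
    ultimately have "?d * ?d \<le> (a0 - a) \<bullet> (a0 - p)"
      by (simp add: inner_diff_left inner_diff_right inner_commute)
    then have "?d \<le> ((a0 - a) \<bullet> (a0 - p)) / ?d"
      using d by (simp add: pos_le_divide_eq)
    then show "?d \<le> (a0 - a) \<bullet> u"
      by (simp add: u_def divide_inverse mult.commute)
  next
    fix a b assume "a \<in> A" "b \<in> A"
    then have "dist a b \<le> diameter ?P"
      using P(1) by (intro diameter_bounded_bound compact_imp_bounded) (auto intro: hull_inc)
    moreover have "(a - b) \<bullet> u \<le> norm (a - b) * norm u"
      by (rule norm_cauchy_schwarz)
    ultimately show "(a - b) \<bullet> u \<le> diameter ?P"
      by (simp add: u1 dist_norm)
  qed
qed

lemma span_differences:
  fixes A :: "(real^'m) set"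
  assumes "aff_dim (convex hull A) = int CARD('m)" "a1 \<in> A"
  shows "span ((\<lambda>a. a - a1) ` A) = UNIV"
proof -
  have "aff_dim A = int (dim ((+) (- a1) ` A))"
    using assms(2) by (intro aff_dim_eq_dim hull_inc)
  moreover have "(+) (- a1) ` A = (\<lambda>a. a - a1) ` A" by (intro image_cong) auto
  ultimately have "dim ((\<lambda>a. a - a1) ` A) = DIM(real^'m)"
    using assms(1) by (simp add: aff_dim_convex_hull)
  then show ?thesis by (simp only: dim_eq_full)
qed

section \<open>Choice of the constants and construction of the open set\<close>

theorem theorem3:
  fixes A :: "(real^'m) set"
    and a0 :: "real^'m"
    and \<alpha> :: "real^'m \<Rightarrow> real"
    and \<alpha>0 :: real
    and M :: "'w measure"
    and \<xi> :: "real^'m \<Rightarrow> 'w \<Rightarrow> real"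
    and \<xi>0 :: "'w \<Rightarrow> real"
  assumes "finite A"
    and "aff_dim (convex hull A) = int CARD('m)"
    and "\<And>a. a \<in> A \<Longrightarrow> \<alpha> a > 0"
    and "a0 \<notin> A"
    and "\<alpha>0 > 0"
    and "prob_space M"
    and "\<And>a. a \<in> A \<Longrightarrow> distributed M lborel (\<xi> a) (\<lambda>t. ennreal (std_normal_density t))"
    and "distributed M lborel \<xi>0 (\<lambda>t. ennreal (std_normal_density t))"
    and "prob_space.indep_vars M (\<lambda>_. borel) (\<xi>(a0 := \<xi>0)) (insert a0 A)"
    and "infdist a0 (convex hull A) > diameter (convex hull A) / real CARD('m)"
  shows "\<exists>U. U \<noteq> {} \<and> \<not> bounded U \<and> open U \<and>
           expected_zeros M (add_exp_term (exp_sum A \<xi> \<alpha>) a0 \<xi>0 \<alpha>0) U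
             < expected_zeros M (exp_sum A \<xi> \<alpha>) U"
proof -
  interpret M: prob_space M by fact
  let ?d = "infdist a0 (convex hull A)" and ?w = "diameter (convex hull A)"
  let ?\<beta> = "\<alpha>(a0 := \<alpha>0)" and ?\<zeta> = "\<xi>(a0 := \<xi>0)"
  have Ane: "A \<noteq> {}" using assms(2) by auto
  have d0: "?d > 0"
  proof -
    have "?w \<ge> 0"
      using assms(1) by (intro diameter_ge_0 compact_imp_bounded finite_imp_compact_convex_hull)
    then have "0 \<le> ?w / real CARD('m)" by simp
    then show ?thesis using assms(10) by linarith
  qed
  obtain u where u1: "norm u = 1" and u': "\<forall>a\<in>A. ?d \<le> (a0 - a) \<bullet> u" "\<forall>a\<in>A. \<forall>b\<in>A. (a - b) \<bullet> u \<le> ?w"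
    by (rule separating_direction[OF assms(1) Ane d0])
  note u = u1 u'(1)[rule_format] u'(2)[rule_format]
  obtain C where C: "C > 0" "\<forall>T\<ge>0. \<exists>a1\<in>A. \<exists>g. (\<forall>a\<in>A - {a1}. pivot_coeff \<alpha> a1 (T *\<^sub>R u) a \<le> 1)
      \<and> (\<forall>i. g i \<in> A - {a1})
      \<and> (\<forall>f. (\<forall>i. f i \<in> A - {a1}) \<longrightarrow> pivot_weight \<alpha> a1 (T *\<^sub>R u) f \<le> pivot_weight \<alpha> a1 (T *\<^sub>R u) g)
      \<and> 0 < pivot_weight \<alpha> a1 (T *\<^sub>R u) g
      \<and> pivot_bound ?\<beta> a0 A (T *\<^sub>R u)
          \<le> C * exp (- T * (real CARD('m) * ?d - ?w)) * pivot_weight \<alpha> a1 (T *\<^sub>R u) g"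
    by (rule pivot_bound_compare[OF assms(1) Ane span_differences[OF assms(2)] assms(3,5,4) u(2,3)])
  define N where "N = enn2real (coeff_moment A) + 1"
  have N: "coeff_moment A \<le> ennreal N" "N > 0"
    using coeff_moment_finite[OF assms(1)]
    by (auto simp: N_def intro: order_trans[OF _ ennreal_leI[of "enn2real (coeff_moment A)"]] add_nonneg_pos)
  have "\<forall>a1\<in>A. \<exists>c>0. ball_zero_bound (A - {a1}) c"
    using assms(1) by (intro ballI ex_ball_zero_bound) simp
  then obtain c where c: "\<forall>a1\<in>A. c a1 > 0 \<and> ball_zero_bound (A - {a1}) (c a1)"
    by (rule bchoice[THEN exE])
  \<comment> \<open>The dominant exponent \<open>a1\<close> depends on \<open>T\<close>, so a
    constant valid for all candidates is fixed first.\<close>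
  obtain c0 where c0: "c0 > 0" "\<forall>a1\<in>A. c a1 > 0 \<longrightarrow> c0 \<le> c a1"
    by (rule finite_bounds[OF assms(1)])
  define \<kappa> where "\<kappa> = real CARD('m) * ?d - ?w"
  have \<kappa>: "\<kappa> > 0" using assms(10) by (simp add: \<kappa>_def field_simps)
  \<comment> \<open>The factor 5 is 4 + 1: around the ball both the Jacobian bound and the volume
    may double, and the neighbourhood of the ray adds at most one further unit.\<close>
  obtain T where T: "T \<ge> 0" "5 * N * (C * exp (- T * \<kappa>)) < c0"
  proof -
    define y where "y = c0 / (5 * N * C)"
    have y: "y > 0" using c0(1) N(2) C(1) by (simp add: y_def)
    define T where "T = max 0 (1 - ln y / \<kappa>)"
    have "- T * \<kappa> < ln y"
    proof -
      have "(1 - ln y / \<kappa>) * \<kappa> \<le> T * \<kappa>"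
        using \<kappa> by (intro mult_right_mono) (auto simp: T_def)
      moreover have "(1 - ln y / \<kappa>) * \<kappa> = \<kappa> - ln y" using \<kappa> by (simp add: field_simps)
      ultimately show ?thesis using \<kappa> by linarith
    qed
    then have "exp (- T * \<kappa>) < y"
      using y by (metis exp_less_mono exp_ln)
    then have "5 * N * (C * exp (- T * \<kappa>)) < c0"
      using N(2) C(1) by (simp add: y_def field_simps)
    then show thesis using that[of T] by (simp add: T_def)
  qed
  define x0 where "x0 = T *\<^sub>R u"
  obtain a1 g where a1: "a1 \<in> A" and g: "\<forall>a\<in>A - {a1}. pivot_coeff \<alpha> a1 x0 a \<le> 1" "\<forall>i. g i \<in> A - {a1}"
      "\<forall>f. (\<forall>i. f i \<in> A - {a1}) \<longrightarrow> pivot_weight \<alpha> a1 x0 f \<le> pivot_weight \<alpha> a1 x0 g"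
      "0 < pivot_weight \<alpha> a1 x0 g"
      "pivot_bound ?\<beta> a0 A x0 \<le> C * exp (- T * \<kappa>) * pivot_weight \<alpha> a1 x0 g"
    using C(2)[rule_format, OF T(1)] unfolding x0_def \<kappa>_def by blast
  define D where "D = pivot_weight \<alpha> a1 x0 g"
  define Q where "Q = C * exp (- T * \<kappa>) * D"
  have D: "D > 0" using g(4) by (simp add: D_def)
  have Q: "Q > 0" using C(1) D by (simp add: Q_def)
  \<comment> \<open>An open set containing the whole ray on which every ratio to the term of
    \<open>a0\<close> is bounded, since its exponent stays below 1. Hence \<open>Kmax\<close> bounds
    the Jacobian uniformly there.\<close>
  define R where "R = {x. \<forall>a\<in>A. (a - a0) \<bullet> x < 1}"
  have R: "open R" "k *\<^sub>R u \<in> R" if "k \<ge> 0" for k :: real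
  proof -
    have "R = (\<Inter>a\<in>A. {x. (a - a0) \<bullet> x < 1})" by (auto simp: R_def)
    then show "open R" using assms(1) by (auto intro!: open_INT open_halfspace_lt)
    have "(a - a0) \<bullet> u \<le> 0" if "a \<in> A" for a
      using u(2)[OF that] d0 by (simp add: inner_diff_left)
    then have "(a - a0) \<bullet> (k *\<^sub>R u) \<le> 0" if "a \<in> A" for a
      using that \<open>k \<ge> 0\<close> by (simp add: mult_nonneg_nonpos)
    then show "k *\<^sub>R u \<in> R" by (fastforce simp: R_def)
  qed
  define Kmax where "Kmax = (\<Sum>f | \<forall>i. f i \<in> A. (\<Prod>i\<in>(UNIV :: 'm set). ?\<beta> (f i) / \<alpha>0 * exp 1) * \<bar>det (\<chi> i. f i - a0)\<bar>)"
  have \<beta>: "?\<beta> a > 0" if "a \<in> insert a0 A" for a using assms(3,5) that by auto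
  have Kmax: "pivot_bound ?\<beta> a0 A x \<le> Kmax" if "x \<in> R" for x
    unfolding pivot_bound_def Kmax_def pivot_weight_def
  proof (intro sum_mono mult_right_mono prod_mono conjI)
    fix f :: "'m \<Rightarrow> real^'m" and i assume "f \<in> {f. \<forall>i. f i \<in> A}"
    then have fA: "f i \<in> A" by simp
    show "0 \<le> pivot_coeff ?\<beta> a0 x (f i)"
      using fA by (intro less_imp_le pivot_coeff_pos \<beta>) auto
    have "(f i - a0) \<bullet> x \<le> 1" using that fA by (auto simp: R_def intro: less_imp_le)
    then show "pivot_coeff ?\<beta> a0 x (f i) \<le> ?\<beta> (f i) / \<alpha>0 * exp 1"
      using \<beta>[of "f i"] fA assms(5) unfolding pivot_coeff_def by (intro mult_mono) auto
  qed auto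
  \<comment> \<open>Nonnegativity serves twice: as a hypothesis of \<open>zeros_majorant\<close> on
    \<open>U2\<close>, and to make \<epsilon> below positive.\<close>
  have Kmax0: "Kmax \<ge> 0"
    unfolding Kmax_def using assms(3,5)
    by (intro sum_nonneg mult_nonneg_nonneg prod_nonneg) (auto intro!: divide_nonneg_pos intro: less_imp_le)
  \<comment> \<open>Around \<open>x0\<close> the upper bound at most doubles, by continuity.\<close>
  define S where "S = {x. pivot_bound ?\<beta> a0 A x < 2 * Q}"
  have S: "open S" "x0 \<in> S"
    using continuous_on_pivot_bound[of UNIV ?\<beta> a0 A] g(5) Q
    by (auto simp: S_def Q_def D_def intro!: open_Collect_less)
  obtain e where e: "e > 0" "ball x0 e \<subseteq> S" using S open_contains_ball by blast
  have "\<forall>\<^sub>F n in sequentially. inverse (real (Suc n)) < e"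
    using LIMSEQ_inverse_real_of_nat e(1) by (rule order_tendstoD)
  moreover have "\<forall>\<^sub>F n in sequentially. ennreal (c a1 * D) * emeasure lborel (cball x0 (inverse (real (Suc n))))
         \<le> (\<integral>\<^sup>+v. of_bool (cball x0 (inverse (real (Suc n))) \<inter> zero_set (insert a1 (A - {a1})) \<alpha> v \<noteq> {}) \<partial>(\<Pi>\<^sub>M a\<in>insert a1 (A - {a1}). gauss))"
    proof -
    have "ball_zero_bound (A - {a1}) (c a1)" using c a1 by blast
    then show ?thesis
      unfolding D_def
      by (rule ball_zero_bound_def[THEN iffD1, rule_format]) (use g a1 assms(3) in auto)
  qed
  ultimately obtain n where n: "inverse (real (Suc n)) < e"
      "ennreal (c a1 * D) * emeasure lborel (cball x0 (inverse (real (Suc n))))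
         \<le> (\<integral>\<^sup>+v. of_bool (cball x0 (inverse (real (Suc n))) \<inter> zero_set (insert a1 (A - {a1})) \<alpha> v \<noteq> {}) \<partial>(\<Pi>\<^sub>M a\<in>insert a1 (A - {a1}). gauss))"
    by (metis (mono_tags, lifting) eventually_conj eventually_happens' sequentially_bot)
  define r where "r = inverse (real (Suc n))"
  have r: "r > 0" "r < e" using n(1) by (simp_all add: r_def)
  let ?B = "cball x0 r"
  define L where "L = measure lborel ?B"
  have L: "L > 0" "emeasure lborel ?B = ennreal L"
    unfolding L_def using content_cball_pos[OF r(1)] emeasure_lborel_cball_finite[of x0 r]
    by (auto intro!: emeasure_eq_ennreal_measure)
  have iA: "insert a1 (A - {a1}) = A" using a1 by auto
  \<comment> \<open>An open neighbourhood of the closed ball with less than twice its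
    volume.\<close>
  obtain O1 where O1: "open O1" "?B \<subseteq> O1" "emeasure lborel (O1 - ?B) < ennreal L"
    by (rule outer_regular_lborel[OF borel_closed[OF closed_cball] L(1)])
  \<comment> \<open>Chosen so that \<open>Kmax * \<epsilon>\<close> is at most \<open>Q * L\<close>;
    the \<open>+ 1\<close> guards against \<open>Kmax = 0\<close>.\<close>
  define \<epsilon> where "\<epsilon> = Q * L / (Kmax + 1)"
  have \<epsilon>: "\<epsilon> > 0" using Q L(1) Kmax0 by (simp add: \<epsilon>_def add_nonneg_pos)
  \<comment> \<open>A countable, hence null, unbounded set on the ray. Outer regularity thickens it
    to an open set of volume at most \<epsilon>.\<close>
  define Z where "Z = range (\<lambda>k::nat. real k *\<^sub>R u)"
  have Z: "countable Z" "Z \<in> sets borel" "emeasure lborel Z = 0"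
  proof -
    show "countable Z" by (simp add: Z_def)
    then show "Z \<in> sets borel" "emeasure lborel Z = 0"
      by (auto intro: emeasure_lborel_countable sets.countable)
  qed
  obtain V where V: "open V" "Z \<subseteq> V" "emeasure lborel (V - Z) < ennreal \<epsilon>"
    using outer_regular_lborel[OF Z(2) \<epsilon>] .
  define U1 where "U1 = O1 \<inter> S"
  define U2 where "U2 = V \<inter> R"
  have U: "open U1" "open U2" using O1 S V R by (auto simp: U1_def U2_def)
  have BU: "?B \<subseteq> U1" using O1(2) e r by (auto simp: U1_def subset_iff)
  have ZU: "Z \<subseteq> U2" using V(2) R(2) by (auto simp: U2_def Z_def)
  have U1L: "emeasure lborel U1 \<le> ennreal (2 * L)"
  proof -
    have "emeasure lborel U1 \<le> emeasure lborel ((O1 - ?B) \<union> ?B)"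
      using O1 by (intro emeasure_mono) (auto simp: U1_def)
    also have "\<dots> \<le> emeasure lborel (O1 - ?B) + emeasure lborel ?B"
      using O1(1) by (intro emeasure_subadditive) auto
    also have "\<dots> \<le> ennreal L + ennreal L"
      using O1(3) L(2) by (intro add_mono) auto
    finally show ?thesis using L(1) by (simp flip: ennreal_plus)
  qed
  have U2L: "emeasure lborel U2 \<le> ennreal \<epsilon>"
  proof -
    have "emeasure lborel U2 \<le> emeasure lborel ((V - Z) \<union> Z)"
      using V Z by (intro emeasure_mono) (auto simp: U2_def)
    also have "\<dots> \<le> emeasure lborel (V - Z) + emeasure lborel Z"
      using V(1) Z by (intro emeasure_subadditive) auto
    finally show ?thesis using V(3) Z(3) by simp
  qed
  have B1: "pivot_bound ?\<beta> a0 A x \<le> 2 * Q" if "x \<in> U1" for x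
    using that Q unfolding U1_def S_def by simp
  have Q2: "0 \<le> 2 * Q" using Q by simp
  have B2: "pivot_bound ?\<beta> a0 A x \<le> Kmax" if "x \<in> U2" for x
    using that Kmax unfolding U2_def by blast
  obtain F1 where F1: "F1 \<in> borel_measurable (\<Pi>\<^sub>M a\<in>insert a0 A. borel)"
      "\<forall>v. emeasure (count_space UNIV) (U1 \<inter> zero_set (insert a0 A) ?\<beta> v) \<le> F1 v"
      "(\<integral>\<^sup>+v. F1 v \<partial>(\<Pi>\<^sub>M a\<in>insert a0 A. gauss)) \<le> coeff_moment A * ennreal (2 * Q) * emeasure lborel U1"
    by (rule zeros_majorant[OF assms(1,4) \<beta> U(1) B1 Q2])
  obtain F2 where F2: "F2 \<in> borel_measurable (\<Pi>\<^sub>M a\<in>insert a0 A. borel)"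
      "\<forall>v. emeasure (count_space UNIV) (U2 \<inter> zero_set (insert a0 A) ?\<beta> v) \<le> F2 v"
      "(\<integral>\<^sup>+v. F2 v \<partial>(\<Pi>\<^sub>M a\<in>insert a0 A. gauss)) \<le> coeff_moment A * ennreal Kmax * emeasure lborel U2"
    by (rule zeros_majorant[OF assms(1,4) \<beta> U(2) B2 Kmax0])
  let ?U = "U1 \<union> U2"
  have dist\<zeta>: "distributed M lborel (?\<zeta> a) (\<lambda>t. ennreal (std_normal_density t))" if "a \<in> insert a0 A" for a
    using assms(7,8) that by auto
  \<comment> \<open>The extra term is absorbed as the exponent \<open>a0\<close> of a larger
    exponential sum, which is unambiguous because \<open>a0\<close> is not in
    \<open>A\<close>.\<close>
  have eq0: "add_exp_term (exp_sum A \<xi> \<alpha>) a0 \<xi>0 \<alpha>0 = exp_sum (insert a0 A) ?\<zeta> ?\<beta>"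
    using assms(1,4) unfolding add_exp_term_def exp_sum_def
    by (auto simp: fun_eq_iff intro!: sum.cong)
  have "expected_zeros M (exp_sum (insert a0 A) ?\<zeta> ?\<beta>) ?U \<le> (\<integral>\<^sup>+v. F1 v + F2 v \<partial>(\<Pi>\<^sub>M a\<in>insert a0 A. gauss))"
  proof (rule expected_zeros_le[OF assms(6) _ assms(9) dist\<zeta>])
    show "(\<lambda>v. F1 v + F2 v) \<in> borel_measurable (\<Pi>\<^sub>M a\<in>insert a0 A. borel)"
      using F1(1) F2(1) by measurable
    show "emeasure (count_space UNIV) (?U \<inter> zero_set (insert a0 A) ?\<beta> v) \<le> F1 v + F2 v" for v
      unfolding Int_Un_distrib2
      by (rule order_trans[OF emeasure_subadditive add_mono[OF F1(2)[rule_format] F2(2)[rule_format]]]) auto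
  qed (use assms(1) in auto)
  also have "\<dots> = (\<integral>\<^sup>+v. F1 v \<partial>(\<Pi>\<^sub>M a\<in>insert a0 A. gauss)) + (\<integral>\<^sup>+v. F2 v \<partial>(\<Pi>\<^sub>M a\<in>insert a0 A. gauss))"
    using F1(1) F2(1) by (intro nn_integral_add) (simp_all only: measurable_cong_sets[OF sets_PiM_gauss refl])
  also have "\<dots> \<le> ennreal N * ennreal (2 * Q) * ennreal (2 * L) + ennreal N * ennreal Kmax * ennreal \<epsilon>"
    by (intro add_mono order_trans[OF F1(3)] order_trans[OF F2(3)] mult_mono N(1) U1L U2L) auto
  also have "\<dots> = ennreal (4 * N * Q * L + N * (Kmax * \<epsilon>))"
    using N Q L(1) Kmax0 \<epsilon> by (simp add: mult_ac flip: ennreal_mult ennreal_plus)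
  also have "\<dots> < ennreal (c a1 * D * L)"
  proof (rule ennreal_lessI)
    show "0 < c a1 * D * L" using c a1 D L(1) by simp
    have "Kmax * \<epsilon> \<le> Q * L"
    proof -
      have "Kmax * \<epsilon> = Q * L * (Kmax / (Kmax + 1))" by (simp add: \<epsilon>_def)
      also have "\<dots> \<le> Q * L * 1"
        using Q L(1) Kmax0 by (intro mult_left_mono) auto
      finally show ?thesis by simp
    qed
    then have "4 * N * Q * L + N * (Kmax * \<epsilon>) \<le> 4 * N * Q * L + N * (Q * L)"
      using N(2) by (intro add_left_mono mult_left_mono) auto
    also have "\<dots> = 5 * N * (C * exp (- T * \<kappa>)) * (D * L)"
      by (simp add: Q_def algebra_simps)
    also have "\<dots> < c0 * (D * L)"
      using T(2) D L(1) by (intro mult_strict_right_mono) auto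
    also have "\<dots> \<le> c a1 * (D * L)"
      using c0(2) c a1 D L(1) by (intro mult_right_mono) auto
    finally show "4 * N * Q * L + N * (Kmax * \<epsilon>) < c a1 * D * L" by (simp add: mult.assoc)
  qed
  also have "ennreal (c a1 * D * L) = ennreal (c a1 * D) * emeasure lborel ?B"
    unfolding L(2) by (rule ennreal_mult) (use L c a1 D in \<open>auto intro!: mult_nonneg_nonneg intro: less_imp_le\<close>)
  \<comment> \<open>For the original system it suffices that some zero exists in the ball, which is
    contained in \<open>U1\<close>.\<close>
  also have "\<dots> \<le> (\<integral>\<^sup>+v. of_bool (?B \<inter> zero_set A \<alpha> v \<noteq> {}) \<partial>(\<Pi>\<^sub>M a\<in>A. gauss))"
    using n(2) unfolding iA r_def .
  also have "\<dots> = emeasure (\<Pi>\<^sub>M a\<in>A. gauss) {v \<in> space (\<Pi>\<^sub>M a\<in>A. borel). ?B \<inter> zero_set A \<alpha> v \<noteq> {}}"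
  proof -
    have "{v \<in> space (\<Pi>\<^sub>M a\<in>A. borel). ?B \<inter> zero_set A \<alpha> v \<noteq> {}} \<in> sets (\<Pi>\<^sub>M a\<in>A. gauss)"
      unfolding sets_PiM_gauss pred_def[symmetric] by (rule pred_zero_in_compact) auto
    from nn_integral_indicator[OF this, symmetric] show ?thesis
      by (simp only:) (intro nn_integral_cong, auto simp: indicator_def space_PiM)
  qed
  also have "\<dots> \<le> expected_zeros M (exp_sum A \<xi> \<alpha>) ?U"
  proof (rule expected_zeros_ge[OF assms(6,1) _ assms(7)])
    \<comment> \<open>Independence is assumed for the whole family; it is restricted to
      \<open>A\<close>, where the updated family agrees with \<xi>.\<close>
    have "M.indep_vars (\<lambda>_. borel) ?\<zeta> A"
      using assms(9) by (rule M.indep_vars_subset) auto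
    then show "M.indep_vars (\<lambda>_. borel) \<xi> A"
      using assms(4) by (subst M.indep_vars_cong[of A A \<xi> ?\<zeta> "\<lambda>_. borel" "\<lambda>_. borel"]) auto
    show "{v \<in> space (\<Pi>\<^sub>M a\<in>A. borel). ?B \<inter> zero_set A \<alpha> v \<noteq> {}} \<in> sets (\<Pi>\<^sub>M a\<in>A. borel)"
      unfolding pred_def[symmetric] by (rule pred_zero_in_compact) auto
  qed (use BU in auto)
  finally have less: "expected_zeros M (add_exp_term (exp_sum A \<xi> \<alpha>) a0 \<xi>0 \<alpha>0) ?U
      < expected_zeros M (exp_sum A \<xi> \<alpha>) ?U"
    unfolding eq0 .
  have "\<not> bounded ?U"
  proof
    assume "bounded ?U"
    then obtain b where b: "\<And>x. x \<in> ?U \<Longrightarrow> norm x \<le> b" by (auto simp: bounded_iff)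
    obtain k :: nat where "b < real k" using reals_Archimedean2 by blast
    moreover have "real k *\<^sub>R u \<in> ?U" using ZU by (auto simp: Z_def)
    ultimately show False using b[of "real k *\<^sub>R u"] u(1) by simp
  qed
  moreover have "?U \<noteq> {}" using ZU by (auto simp: Z_def)
  ultimately show ?thesis
    using U less by (intro exI[of _ ?U]) auto
qed

end
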